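(* Let $M$ be a $d\times d$ integer matrix with an integer eigenvalue $m$ with $|m|>1$. Then there is a constant $\delta=\delta(M)>0$ such that if $G:\mathbb{R}^d\to\mathbb{R}^d$ is a $C^1$, $1$-periodic map satisfying $\|G\|_{C^1}<\delta$, then the torus map $F:\mathbb{T}^d\to\mathbb{T}^d$ given by $F(z)=Mz+G(z)\bmod 1$ is conjugate to a skew-product map of the form $$(x,y)\mapsto (Ax,\ F_y(x,y))\bmod 1,\qquad x\in\mathbb{T}^k,\ y\in\mathbb{T}^{d-k},$$ where $A$ is a $k\times k$ expanding integer matrix (for some $1\le k\le d$) and $F_y:\mathbb{T}^k\times\mathbb{T}^{d-k}\to\mathbb{T}^{d-k}$ is continuous.
   Context: $\mathbb{T}^d=\mathbb{R}^d/\mathbb{Z}^d$. $1$-periodic means $G(z+\vec m)=G(z)$ for all $\vec m\in\mathbb{Z}^d$. $\|G\|_{C^1}$ is the $C^1$-norm, $\sup_z\|G(z)\|+\sup_z\|DG(z)\|$. A square matrix is expanding if all its eigenvalues have modulus greater than $1$. Two maps $F:X\to X$ and $F':X'\to X'$ are conjugate if there is a homeomorphism $H:X\to X'$ with $H\circ F=F'\circ H$. *)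

theory Defs
  imports "Jordan_Normal_Form.Char_Poly" "HOL-Analysis.Analysis"
begin

subsection \<open>The torus as a quotient of Euclidean space\<close>

definition quotient_topology :: "'a topology \<Rightarrow> ('a \<Rightarrow> 'b) \<Rightarrow> 'b topology" where
  "quotient_topology X q =
     topology (\<lambda>U. U \<subseteq> q ` topspace X \<and> openin X {x \<in> topspace X. q x \<in> U})"

lemma openin_quotient_topology:
  "openin (quotient_topology X q) U \<longleftrightarrow>
     U \<subseteq> q ` topspace X \<and> openin X {x \<in> topspace X. q x \<in> U}"
proof -
  have "istopology (\<lambda>U. U \<subseteq> q ` topspace X \<and> openin X {x \<in> topspace X. q x \<in> U})"
    unfolding istopology_def
  proof (intro conjI allI impI)
    fix S T
    assume "S \<subseteq> q ` topspace X \<and> openin X {x \<in> topspace X. q x \<in> S}"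
      and "T \<subseteq> q ` topspace X \<and> openin X {x \<in> topspace X. q x \<in> T}"
    then have S: "S \<subseteq> q ` topspace X" and oS: "openin X {x \<in> topspace X. q x \<in> S}"
      and oT: "openin X {x \<in> topspace X. q x \<in> T}" by auto
    show "S \<inter> T \<subseteq> q ` topspace X" using S by blast
    have "{x \<in> topspace X. q x \<in> S \<inter> T} =
        {x \<in> topspace X. q x \<in> S} \<inter> {x \<in> topspace X. q x \<in> T}" by blast
    then show "openin X {x \<in> topspace X. q x \<in> S \<inter> T}"
      using openin_Int[OF oS oT] by (simp only:)
  next
    fix K
    assume K: "\<forall>S\<in>K. S \<subseteq> q ` topspace X \<and> openin X {x \<in> topspace X. q x \<in> S}"
    then show "\<Union>K \<subseteq> q ` topspace X" by blast
    have "{x \<in> topspace X. q x \<in> \<Union>K} = (\<Union>S\<in>K. {x \<in> topspace X. q x \<in> S})" by blast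
    then show "openin X {x \<in> topspace X. q x \<in> \<Union>K}" using K by auto
  qed
  then show ?thesis
    unfolding quotient_topology_def by simp
qed

lemma topspace_quotient_topology: "topspace (quotient_topology X q) = q ` topspace X"
proof
  show "topspace (quotient_topology X q) \<subseteq> q ` topspace X"
    using openin_quotient_topology[of X q "topspace (quotient_topology X q)"] by simp
  have "{x \<in> topspace X. q x \<in> q ` topspace X} = topspace X" by blast
  then have "openin (quotient_topology X q) (q ` topspace X)"
    by (simp add: openin_quotient_topology)
  then show "q ` topspace X \<subseteq> topspace (quotient_topology X q)"
    by (rule openin_subset)
qed

lemma quotient_map_quotient_topology: "quotient_map X (quotient_topology X q) q"
  by (auto simp: quotient_map_def topspace_quotient_topology openin_quotient_topology)

text \<open>
  Since the dimension of a factor of the target torus is existentially quantified, it cannot be a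
  type. Euclidean space is therefore taken with a finite coordinate set \<open>I\<close>: its points are the
  functions in \<open>extensional I\<close> and its topology is the product topology. A point of the torus is
  a coset of the integer lattice.
\<close>

definition torus_class :: "'i set \<Rightarrow> ('i \<Rightarrow> real) \<Rightarrow> ('i \<Rightarrow> real) set" where
  "torus_class I x = {y \<in> extensional I. \<forall>i\<in>I. y i - x i \<in> \<int>}"

definition torus :: "'i set \<Rightarrow> ('i \<Rightarrow> real) set topology" where
  "torus I = quotient_topology (product_topology (\<lambda>_. euclideanreal) I) (torus_class I)"

text \<open>
  The map \<open>x \<mapsto> f x mod 1\<close>. The union is over a constant family, so it is the common value,
  whenever \<open>f\<close> sends points congruent modulo 1 to points congruent modulo 1.
\<close>

definition torus_map ::
    "'i set \<Rightarrow> (('i \<Rightarrow> real) \<Rightarrow> 'i \<Rightarrow> real) \<Rightarrow> ('i \<Rightarrow> real) set \<Rightarrow> ('i \<Rightarrow> real) set" where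
  "torus_map I f C = (\<Union>x\<in>C. torus_class I (f x))"

lemma torus_class_eq:
  assumes "\<And>i. i \<in> I \<Longrightarrow> x i - y i \<in> \<int>"
  shows "torus_class I x = torus_class I y"
proof -
  have "z - x i \<in> \<int> \<longleftrightarrow> z - y i \<in> \<int>" if "i \<in> I" for i and z :: real
  proof
    assume "z - x i \<in> \<int>"
    from Ints_add[OF this assms[OF that]] show "z - y i \<in> \<int>" by simp
  next
    assume "z - y i \<in> \<int>"
    from Ints_diff[OF this assms[OF that]] show "z - x i \<in> \<int>" by simp
  qed
  then show ?thesis by (auto simp: torus_class_def)
qed

lemma torus_map_class:
  assumes "x \<in> extensional I"
    and "\<And>y i. y \<in> extensional I \<Longrightarrow> (\<And>j. j \<in> I \<Longrightarrow> y j - x j \<in> \<int>) \<Longrightarrow> i \<in> I \<Longrightarrow> f y i - f x i \<in> \<int>"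
  shows "torus_map I f (torus_class I x) = torus_class I (f x)"
proof -
  have "torus_class I (f y) = torus_class I (f x)" if "y \<in> torus_class I x" for y
    using that by (intro torus_class_eq assms(2)) (auto simp: torus_class_def)
  moreover have "x \<in> torus_class I x"
    using assms(1) by (simp add: torus_class_def)
  ultimately show ?thesis
    unfolding torus_map_def by blast
qed

subsection \<open>\<open>C\<^sup>1\<close> periodic maps\<close>

definition one_periodic :: "(real ^ 'd \<Rightarrow> real ^ 'd) \<Rightarrow> bool" where
  "one_periodic G \<longleftrightarrow> (\<forall>z. \<forall>p :: int ^ 'd. G (z + (\<chi> i. real_of_int (vec_nth p i))) = G z)"

definition C1_map :: "(real ^ 'd \<Rightarrow> real ^ 'd) \<Rightarrow> bool" where
  "C1_map G \<longleftrightarrow>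
     (\<exists>G' :: real ^ 'd \<Rightarrow> (real ^ 'd) \<Rightarrow>\<^sub>L (real ^ 'd).
        (\<forall>z. (G has_derivative blinfun_apply (G' z)) (at z)) \<and> continuous_on UNIV G')"

text \<open>
  The real-valued suprema are meaningful because a \<open>C\<^sup>1\<close> periodic map and its derivative are
  bounded; the norm is only used for such maps.
\<close>

definition C1_norm :: "(real ^ 'd \<Rightarrow> real ^ 'd) \<Rightarrow> real" where
  "C1_norm G = (SUP z. norm (G z)) + (SUP z. onorm (frechet_derivative G (at z)))"

lemma torus_map_perturbed_linear:
  fixes M :: "int ^ 'd ^ 'd"
  assumes "one_periodic G"
  shows "torus_map UNIV (vec_nth \<circ> (\<lambda>z. map_matrix real_of_int M *v z + G z) \<circ> vec_lambda)
           (torus_class UNIV (vec_nth z)) =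
         torus_class UNIV (vec_nth (map_matrix real_of_int M *v z + G z))"
proof -
  let ?f = "vec_nth \<circ> (\<lambda>z. map_matrix real_of_int M *v z + G z) \<circ> vec_lambda"
  have "torus_map UNIV ?f (torus_class UNIV (vec_nth z)) = torus_class UNIV (?f (vec_nth z))"
  proof (rule torus_map_class)
    fix y :: "'d \<Rightarrow> real" and i :: 'd
    assume y: "\<And>j. j \<in> UNIV \<Longrightarrow> y j - vec_nth z j \<in> \<int>"
    define p :: "int ^ 'd" where "p = (\<chi> j. \<lfloor>y j - vec_nth z j\<rfloor>)"
    define q :: "real ^ 'd" where "q = (\<chi> j. real_of_int (vec_nth p j))"
    have "y j = vec_nth z j + vec_nth q j" for j
      using y[of j] by (auto simp: q_def p_def elim!: Ints_cases)
    then have w: "vec_lambda y = z + q"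
      by (simp add: vec_eq_iff)
    have "G (z + q) = G z"
      using assms unfolding one_periodic_def q_def by blast
    then have "?f y i - ?f (vec_nth z) i = vec_nth (map_matrix real_of_int M *v q) i"
      by (simp add: w matrix_vector_right_distrib)
    also have "\<dots> \<in> \<int>"
      by (auto simp: matrix_vector_mult_def q_def intro!: Ints_sum Ints_mult)
    finally show "?f y i - ?f (vec_nth z) i \<in> \<int>" .
  qed simp
  then show ?thesis by simp
qed

subsection \<open>Integer matrices and skew products\<close>

definition expanding :: "int mat \<Rightarrow> bool" where
  "expanding A \<longleftrightarrow> (\<forall>\<mu>. eigenvalue (map_mat complex_of_int A) \<mu> \<longrightarrow> 1 < cmod \<mu>)"

definition mat_act :: "int mat \<Rightarrow> (nat \<Rightarrow> real) \<Rightarrow> nat \<Rightarrow> real" where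
  "mat_act A x = (\<lambda>i\<in>{..<dim_row A}. \<Sum>j<dim_col A. real_of_int (A $$ (i, j)) * x j)"

lemma torus_map_mat_act:
  assumes "A \<in> carrier_mat k k" and "x \<in> extensional {..<k}"
  shows "torus_map {..<k} (mat_act A) (torus_class {..<k} x) = torus_class {..<k} (mat_act A x)"
proof (rule torus_map_class[OF assms(2)])
  fix y i
  assume y: "\<And>j. j \<in> {..<k} \<Longrightarrow> y j - x j \<in> \<int>" and i: "i \<in> {..<k}"
  have "mat_act A y i - mat_act A x i = (\<Sum>j<k. real_of_int (A $$ (i, j)) * (y j - x j))"
    using assms(1) i by (simp add: mat_act_def sum_subtractf algebra_simps)
  also have "\<dots> \<in> \<int>"
    using y by (intro Ints_sum Ints_mult) auto
  finally show "mat_act A y i - mat_act A x i \<in> \<int>" .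
qed

definition skew_product ::
    "int mat \<Rightarrow> ((nat \<Rightarrow> real) set \<times> 'b \<Rightarrow> 'b) \<Rightarrow> (nat \<Rightarrow> real) set \<times> 'b \<Rightarrow> (nat \<Rightarrow> real) set \<times> 'b"
  where "skew_product A Fy = (\<lambda>(x, y). (torus_map {..<dim_row A} (mat_act A) x, Fy (x, y)))"

definition conjugate_maps ::
    "'a topology \<Rightarrow> ('a \<Rightarrow> 'a) \<Rightarrow> 'b topology \<Rightarrow> ('b \<Rightarrow> 'b) \<Rightarrow> bool" where
  "conjugate_maps X F X' F' \<longleftrightarrow>
     (\<exists>H. homeomorphic_map X X' H \<and> (\<forall>x \<in> topspace X. H (F x) = F' (H x)))"

end

theory Submission
  imports Defs
begin

text \<open>
  Write \<open>f z = M z + G z\<close> on \<open>\<real>\<^sup>d\<close>. The determinant of \<open>M - m\<close> vanishes over the reals, hence over the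
  rationals, so there is an integer row vector \<open>w \<noteq> 0\<close> with \<open>w M = m w\<close>. Euclid's algorithm on its
  entries makes \<open>w\<close> a multiple of a row of a unimodular matrix \<open>R\<close>. In the coordinates \<open>R z\<close> the
  linear map is therefore already a skew product over multiplication by \<open>m\<close> on the circle. The
  theorem follows with \<open>k = 1\<close> and \<open>A = (m)\<close> once the perturbed map is conjugated, by a map \<open>K\<close>
  that descends to the torus, to one whose \<open>w\<close>-component is still exactly multiplied by \<open>m\<close>.

  The obvious semiconjugacy \<open>w \<bullet> z + h z\<close> to multiplication by \<open>m\<close> is in general only Hoelder
  continuous, and it need not be monotone in any fixed direction, because \<open>M\<close> may expand other directions faster than
  \<open>m\<close>. So all fast directions are straightened at once. Let \<open>V\<close> be the invariant subspace
  of vectors whose orbits grow at most like \<open>\<rho>\<^sup>n\<close>, for a rate \<open>1 < \<rho> < \<bar>m\<bar>\<close>. As \<open>\<rho>\<close> varies, only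
  finitely many dimensions occur, so \<open>\<rho>\<close> can be chosen in a gap, where \<open>V\<close> is the same for all
  slightly larger rates. Compactness then shows that \<open>M\<close> expands the quotient by \<open>V\<close> uniformly, at a
  rate \<open>\<tau> > \<rho>\<close> (\<open>dominated_splitting_exists\<close>). The functional \<open>w\<close>
  vanishes on \<open>V\<close> because \<open>\<bar>m\<bar> > \<rho>\<close> (\<open>functional_vanishes\<close>).

  Let \<open>Q\<close> be the projection with kernel \<open>V\<close> onto some complement. Since \<open>M\<close> expands the quotient, a
  geometrically convergent series yields a bounded continuous periodic \<open>h\<close> with values in the complement such that
  \<open>K z = z + h z\<close> satisfies \<open>Q (K (f z)) = Q (M (K z))\<close> (\<open>semiconjugacy\<close>); applying \<open>w\<close>, which
  factors through \<open>Q\<close>, gives \<open>w \<bullet> K (f z) = m (w \<bullet> K z)\<close>. The map \<open>K\<close> is onto by Brouwer's theorem,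
  being a bounded perturbation of the identity. It is injective by a cone argument
  (\<open>injectivity_scale\<close>): if \<open>K x = K y\<close> then \<open>x - y\<close> lies in the complement, so under iteration the
  difference of the orbits stays in a cone around the complement and its \<open>Q\<close>-part grows
  exponentially, whereas \<open>h\<close> bounds that part. Invariance of domain makes \<open>K\<close> a homeomorphism.

  Finally both tori are quotients of \<open>\<real>\<^sup>d\<close> whose fibres are the cosets of the integer lattice, and
  \<open>z \<mapsto> R (K z)\<close> respects these cosets, so it induces the conjugating homeomorphism.
\<close>

section \<open>Subspaces of slow exponential growth\<close>

definition growth_space :: "('a::euclidean_space \<Rightarrow> 'a) \<Rightarrow> real \<Rightarrow> 'a set" where
  "growth_space M \<rho> = {z. \<exists>D. \<forall>n. norm ((M ^^ n) z) \<le> D * \<rho> ^ n}"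

lemma linear_funpow: "linear M \<Longrightarrow> linear (M ^^ n)" for M :: "'a::real_vector \<Rightarrow> 'a"
proof (induction n)
  case 0
  then show ?case by (simp add: linear_iff)
next
  case (Suc n)
  then show ?case using linear_compose[of "M ^^ n" M] by (simp add: o_def)
qed

lemma growth_spaceI: "(\<And>n. norm ((M ^^ n) z) \<le> D * \<rho> ^ n) \<Longrightarrow> z \<in> growth_space M \<rho>"
  by (auto simp: growth_space_def)

lemma subspace_growth_space:
  fixes M :: "'a::euclidean_space \<Rightarrow> 'a"
  assumes "linear M"
  shows "subspace (growth_space M \<rho>)"
  unfolding subspace_def
proof (intro conjI ballI allI)
  have lin: "linear (M ^^ n)" for n using assms by (rule linear_funpow)
  show "0 \<in> growth_space M \<rho>"
    by (intro growth_spaceI[where D = 0]) (simp add: linear_0[OF lin])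
  fix x y :: 'a and c :: real
  assume "x \<in> growth_space M \<rho>"
  then obtain D where D: "\<And>n. norm ((M ^^ n) x) \<le> D * \<rho> ^ n" by (auto simp: growth_space_def)
  show "c *\<^sub>R x \<in> growth_space M \<rho>"
  proof (rule growth_spaceI[where D = "\<bar>c\<bar> * D"])
    fix n show "norm ((M ^^ n) (c *\<^sub>R x)) \<le> \<bar>c\<bar> * D * \<rho> ^ n"
      using mult_left_mono[OF D[of n], of "\<bar>c\<bar>"] by (simp add: linear_cmul[OF lin] mult.assoc)
  qed
  assume "y \<in> growth_space M \<rho>"
  then obtain D' where D': "\<And>n. norm ((M ^^ n) y) \<le> D' * \<rho> ^ n" by (auto simp: growth_space_def)
  show "x + y \<in> growth_space M \<rho>"
  proof (rule growth_spaceI[where D = "D + D'"])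
    fix n show "norm ((M ^^ n) (x + y)) \<le> (D + D') * \<rho> ^ n"
      using norm_triangle_mono[OF D[of n] D'[of n]] by (simp add: linear_add[OF lin] distrib_right)
  qed
qed

lemma growth_space_mono:
  assumes "0 \<le> \<rho>" "\<rho> \<le> \<sigma>"
  shows "growth_space M \<rho> \<subseteq> growth_space M \<sigma>"
proof
  fix z assume "z \<in> growth_space M \<rho>"
  then obtain D where D: "\<And>n. norm ((M ^^ n) z) \<le> D * \<rho> ^ n" by (auto simp: growth_space_def)
  have "0 \<le> D" using D[of 0] norm_ge_zero[of z] by (simp del: norm_ge_zero)
  show "z \<in> growth_space M \<sigma>"
  proof (rule growth_spaceI)
    fix n show "norm ((M ^^ n) z) \<le> D * \<sigma> ^ n"
      using D[of n] mult_left_mono[OF power_mono[OF assms(2,1), of n] \<open>0 \<le> D\<close>] by linarith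
  qed
qed

lemma growth_space_invariant:
  assumes "z \<in> growth_space M \<rho>"
  shows "M z \<in> growth_space M \<rho>"
proof -
  obtain D where D: "\<And>n. norm ((M ^^ n) z) \<le> D * \<rho> ^ n" using assms by (auto simp: growth_space_def)
  show ?thesis
  proof (rule growth_spaceI)
    fix n show "norm ((M ^^ n) (M z)) \<le> (D * \<rho>) * \<rho> ^ n"
      using D[of "Suc n"] by (simp only: funpow_Suc_right o_apply power_Suc mult.assoc)
  qed
qed

text \<open>
  The dimension of \<open>growth_space M \<rho>\<close> takes finitely many values, so it agrees at two different rates
  below \<open>r\<close>; by monotonicity the two subspaces are then equal. The gap plays the part of a
  circle that separates the eigenvalues by modulus.
\<close>
lemma growth_space_gap:
  fixes M :: "'a::euclidean_space \<Rightarrow> 'a"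
  assumes "linear M" "1 < r"
  obtains \<sigma> \<tau> where "1 < \<sigma>" "\<sigma> < \<tau>" "\<tau> < r" "growth_space M \<sigma> = growth_space M \<tau>"
proof -
  have "(\<lambda>\<rho>. dim (growth_space M \<rho>)) ` {1<..<r} \<subseteq> {..DIM('a)}"
    using dim_subset_UNIV by auto
  then have "finite ((\<lambda>\<rho>. dim (growth_space M \<rho>)) ` {1<..<r})"
    by (rule finite_subset) simp
  then have "\<not> inj_on (\<lambda>\<rho>. dim (growth_space M \<rho>)) {1<..<r}"
    using infinite_Ioo[OF assms(2)] finite_imageD by blast
  then obtain a b where ab: "1 < a" "a < r" "1 < b" "b < r" "a \<noteq> b"
    and eq: "dim (growth_space M a) = dim (growth_space M b)"
    by (auto simp: inj_on_def)
  define \<sigma> \<tau> where "\<sigma> = min a b" and "\<tau> = max a b"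
  have *: "1 < \<sigma>" "\<sigma> < \<tau>" "\<tau> < r" "dim (growth_space M \<sigma>) = dim (growth_space M \<tau>)"
    using ab eq by (auto simp: \<sigma>_def \<tau>_def min_def max_def)
  moreover have "growth_space M \<sigma> = growth_space M \<tau>"
    using * by (intro subspace_dim_equal subspace_growth_space assms growth_space_mono) auto
  ultimately show thesis using that by blast
qed

text \<open>
  The growth constant may depend on the vector; expanding in a basis makes it uniform.
\<close>
lemma growth_space_uniform:
  fixes M P :: "'a::euclidean_space \<Rightarrow> 'a"
  assumes "linear M" "linear P" "\<And>z. P z \<in> growth_space M \<rho>"
  obtains C where "0 \<le> C" "\<And>n z. norm ((M ^^ n) (P z)) \<le> C * \<rho> ^ n * norm z"
proof -
  have "\<exists>D. \<forall>i n. norm ((M ^^ n) (P i)) \<le> D i * \<rho> ^ n"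
    using assms(3) unfolding growth_space_def by (intro choice) auto
  then obtain D where D: "\<And>i n. norm ((M ^^ n) (P i)) \<le> D i * \<rho> ^ n" by blast
  have "0 \<le> D i" for i using D[of 0 i] norm_ge_zero[of "P i"] by (simp del: norm_ge_zero)
  then have D0: "0 \<le> sum D Basis" by (simp add: sum_nonneg)
  have "norm ((M ^^ n) (P z)) \<le> sum D Basis * \<rho> ^ n * norm z" for n z
  proof -
    have lin: "linear (\<lambda>z. (M ^^ n) (P z))"
      using linear_compose[OF assms(2) linear_funpow[OF assms(1)]] by (simp add: o_def)
    have "(M ^^ n) (P z) = (M ^^ n) (P (\<Sum>i\<in>Basis. (z \<bullet> i) *\<^sub>R i))"
      by (simp add: euclidean_representation)
    also have "\<dots> = (\<Sum>i\<in>Basis. (z \<bullet> i) *\<^sub>R (M ^^ n) (P i))"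
      by (simp add: linear_sum[OF lin] linear_cmul[OF lin])
    also have "norm \<dots> \<le> (\<Sum>i\<in>Basis. norm z * (D i * \<rho> ^ n))"
      by (rule sum_norm_le) (auto intro!: mult_mono D Basis_le_norm)
    also have "\<dots> = sum D Basis * \<rho> ^ n * norm z"
      by (simp add: sum_distrib_left sum_distrib_right mult_ac)
    finally show ?thesis .
  qed
  with D0 show thesis using that by blast
qed

text \<open>
  Averaging along a finite piece of the orbit gives a Lyapunov norm: applying \<open>T\<close> shifts the sum,
  so a comparison of \<open>T ^^ N\<close> with \<open>\<rho> ^ N\<close> in the original norm becomes a comparison of one step
  of \<open>T\<close> with \<open>\<rho>\<close> in the new one. A finite sum suffices, and this makes equivalence with
  the original norm immediate.
\<close>
definition adapted_norm :: "('a::real_normed_vector \<Rightarrow> 'a) \<Rightarrow> real \<Rightarrow> nat \<Rightarrow> 'a \<Rightarrow> real" where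
  "adapted_norm T \<rho> N z = (\<Sum>n<N. norm ((T ^^ n) z) / \<rho> ^ n)"

lemma adapted_norm_step:
  assumes "\<rho> > 0"
  shows "adapted_norm T \<rho> N (T z) =
    \<rho> * (adapted_norm T \<rho> N z - norm z + norm ((T ^^ N) z) / \<rho> ^ N)"
proof -
  have "adapted_norm T \<rho> N (T z) = \<rho> * (\<Sum>n<N. norm ((T ^^ Suc n) z) / \<rho> ^ Suc n)"
    using assms unfolding adapted_norm_def sum_distrib_left
    by (intro sum.cong) (simp_all add: funpow_swap1)
  also have "(\<Sum>n<N. norm ((T ^^ Suc n) z) / \<rho> ^ Suc n) =
      (\<Sum>n<Suc N. norm ((T ^^ n) z) / \<rho> ^ n) - norm z"
    by (simp only: sum.lessThan_Suc_shift) simp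
  finally show ?thesis by (simp add: adapted_norm_def)
qed

lemma adapted_norm_triangle:
  assumes "linear T" "\<rho> > 0"
  shows "adapted_norm T \<rho> N (x + y) \<le> adapted_norm T \<rho> N x + adapted_norm T \<rho> N y"
  unfolding adapted_norm_def sum.distrib[symmetric]
  using assms(2) by (intro sum_mono)
    (simp add: linear_add[OF linear_funpow[OF assms(1)]] add_divide_distrib[symmetric]
      divide_right_mono norm_triangle_ineq)

lemma adapted_norm_ge:
  assumes "\<rho> > 0" "N > 0"
  shows "norm z \<le> adapted_norm T \<rho> N z"
proof -
  have "norm ((T ^^ 0) z) / \<rho> ^ 0 \<le> adapted_norm T \<rho> N z"
    unfolding adapted_norm_def using assms by (intro member_le_sum) auto
  then show ?thesis by simp
qed

lemma adapted_norm_bound: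
  fixes T :: "'a::euclidean_space \<Rightarrow> 'a"
  assumes "linear T" "\<rho> > 0"
  obtains C where "0 < C" "\<And>z. adapted_norm T \<rho> N z \<le> C * norm z"
proof -
  have "\<exists>C. \<forall>n. 0 < C n \<and> (\<forall>z. norm ((T ^^ n) z) \<le> C n * norm z)"
    using linear_bounded_pos[OF linear_funpow[OF assms(1)]] by (intro choice) blast
  then obtain C where C: "\<And>n. 0 < C n" "\<And>n z. norm ((T ^^ n) z) \<le> C n * norm z" by blast
  have "adapted_norm T \<rho> N z \<le> ((\<Sum>n<N. C n / \<rho> ^ n) + 1) * norm z" for z
  proof -
    have "adapted_norm T \<rho> N z \<le> (\<Sum>n<N. C n * norm z / \<rho> ^ n)"
      unfolding adapted_norm_def using assms C by (intro sum_mono divide_right_mono) auto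
    also have "\<dots> = (\<Sum>n<N. C n / \<rho> ^ n) * norm z" by (simp add: sum_distrib_right)
    finally show ?thesis using norm_ge_zero[of z] by (simp add: distrib_right del: norm_ge_zero)
  qed
  moreover have "0 < (\<Sum>n<N. C n / \<rho> ^ n) + 1"
    using C(1) assms by (intro add_nonneg_pos sum_nonneg) (auto intro: less_imp_le)
  ultimately show thesis using that by blast
qed

lemma exponential_ratio:
  fixes \<rho> \<sigma> :: real
  assumes "0 < \<rho>" "\<rho> < \<sigma>"
  obtains N where "N > 0" "C * \<rho> ^ N \<le> \<sigma> ^ N"
proof -
  obtain N where N: "C < (\<sigma> / \<rho>) ^ N"
    using real_arch_pow[of "\<sigma> / \<rho>" C] assms by auto
  have "(\<sigma> / \<rho>) ^ N \<le> (\<sigma> / \<rho>) ^ Suc N"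
    using assms by (intro power_increasing) auto
  with N have "C < (\<sigma> / \<rho>) ^ Suc N" by linarith
  then have "C * \<rho> ^ Suc N \<le> \<sigma> ^ Suc N"
    using assms by (simp add: power_divide field_simps)
  then show thesis using that by blast
qed

text \<open>
  If every nonzero orbit in \<open>S\<close> exceeds each multiple of \<open>\<tau> ^ n\<close> at some time, then compactness of the unit sphere
  gives a bound \<open>N\<close> such that each vector is expanded at rate \<open>\<tau>\<close> at some time between \<open>1\<close> and \<open>N\<close>.
  Concatenating such stretches, with injectivity of \<open>T\<close> on \<open>S\<close> covering the last incomplete one,
  gives expansion at rate \<open>\<tau>\<close> at all times, up to a constant.
\<close>
lemma uniform_expansion:
  fixes T :: "'a::euclidean_space \<Rightarrow> 'a"
  assumes lin: "linear T" and S: "subspace S" and inv: "\<And>b. b \<in> S \<Longrightarrow> T b \<in> S"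
    and \<tau>: "0 < \<tau>"
    and unbdd: "\<And>b D. b \<in> S \<Longrightarrow> (\<And>n. norm ((T ^^ n) b) \<le> D * \<tau> ^ n) \<Longrightarrow> b = 0"
  shows "\<exists>c>0. \<forall>n. \<forall>b\<in>S. c * \<tau> ^ n * norm b \<le> norm ((T ^^ n) b)"
proof -
  have linT: "linear (T ^^ n)" for n using lin by (rule linear_funpow)
  have invn: "(T ^^ n) b \<in> S" if "b \<in> S" for n b
    using that by (induction n) (auto intro: inv)
  define U where "U n = {b. \<tau> ^ n < norm ((T ^^ n) b)}" for n
  have "compact (sphere 0 1 \<inter> S)"
    by (intro compact_Int_closed compact_sphere closed_subspace S)
  moreover have "open (U n)" for n
    unfolding U_def
    by (intro open_Collect_less continuous_intros linear_continuous_on[unfolded linear_conv_bounded_linear]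
        linear_continuous_on linT[unfolded linear_conv_bounded_linear])
  moreover have "sphere 0 1 \<inter> S \<subseteq> (\<Union>n. U n)"
  proof
    fix b assume b: "b \<in> sphere 0 1 \<inter> S"
    then have "b \<noteq> 0" by auto
    with unbdd[of b 1] b have "\<exists>n. \<not> norm ((T ^^ n) b) \<le> \<tau> ^ n" by auto
    then show "b \<in> (\<Union>n. U n)" by (auto simp: U_def not_le)
  qed
  ultimately obtain I where I: "finite I" "sphere 0 1 \<inter> S \<subseteq> (\<Union>n\<in>I. U n)"
    by (metis (no_types, lifting) compactE_image UNIV_I)
  have grow: "\<exists>n\<in>I. 0 < n \<and> \<tau> ^ n * norm b \<le> norm ((T ^^ n) b)" if b: "b \<in> S" "b \<noteq> 0" for b
  proof -
    have "b /\<^sub>R norm b \<in> sphere 0 1 \<inter> S"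
      using b by (auto intro: subspace_scale[OF S])
    then obtain n where n: "n \<in> I" "\<tau> ^ n < norm ((T ^^ n) (b /\<^sub>R norm b))"
      using I(2) unfolding U_def by blast
    have "n \<noteq> 0" using n(2) b by (auto intro: ccontr)
    moreover have "\<tau> ^ n * norm b \<le> norm ((T ^^ n) b)"
      using n(2) b by (simp add: linear_cmul[OF linT] field_simps)
    ultimately show ?thesis using n(1) by auto
  qed
  have kernel: "x = 0" if "x \<in> S" "(T ^^ k) x = 0" for x k
    using that
  proof (induction k arbitrary: x)
    case (Suc k)
    have "T x = 0" using Suc.IH[of "T x"] Suc.prems inv by (simp add: funpow_swap1)
    then have "(T ^^ j) x = (if j = 0 then x else 0)" for j
      by (induction j) (auto simp: linear_0[OF lin])
    then show ?case
      using \<tau> by (intro unbdd[OF \<open>x \<in> S\<close>, of "norm x"]) auto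
  qed simp
  have low: "\<exists>c>0. \<forall>b\<in>S. c * \<tau> ^ n * norm b \<le> norm ((T ^^ n) b)" for n
  proof -
    have "\<exists>e>0. \<forall>x\<in>S. norm ((T ^^ n) x) \<ge> e * norm x"
    proof (rule injective_imp_isometric)
      show "\<forall>x\<in>S. (T ^^ n) x = 0 \<longrightarrow> x = 0" using kernel by blast
    qed (use S linT in \<open>auto simp: closed_subspace linear_conv_bounded_linear\<close>)
    then obtain e where e: "e > 0" "\<forall>x\<in>S. norm ((T ^^ n) x) \<ge> e * norm x" by blast
    then show ?thesis using \<tau> by (intro exI[of _ "e / \<tau> ^ n"]) auto
  qed
  then obtain c where c: "\<And>n. 0 < c n" "\<And>n b. b \<in> S \<Longrightarrow> c n * \<tau> ^ n * norm b \<le> norm ((T ^^ n) b)"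
    by metis
  define N where "N = Max (insert 0 I)"
  define c0 where "c0 = Min (c ` {..N})"
  have c0: "0 < c0" "n \<le> N \<Longrightarrow> c0 \<le> c n" for n
    using c(1) by (auto simp: c0_def)
  have "c0 * \<tau> ^ n * norm b \<le> norm ((T ^^ n) b)" if "b \<in> S" for n b
    using that
  proof (induction n arbitrary: b rule: less_induct)
    case (less n)
    consider "b = 0" | "n \<le> N" | "b \<noteq> 0" "N < n" by linarith
    then show ?case
    proof cases
      case 2
      have "c0 * (\<tau> ^ n * norm b) \<le> c n * (\<tau> ^ n * norm b)"
        using c0(2)[OF 2] \<tau> by (intro mult_right_mono) auto
      then show ?thesis using c(2)[OF less.prems, of n] by (simp add: mult.assoc)
    next
      case 3
      obtain j where j: "j \<in> I" "0 < j" "\<tau> ^ j * norm b \<le> norm ((T ^^ j) b)"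
        using grow[OF less.prems 3(1)] by blast
      have "j \<le> N" using j(1) I(1) by (simp add: N_def)
      then have jn: "n = (n - j) + j" using 3 by simp
      have "c0 * \<tau> ^ n * norm b = c0 * \<tau> ^ (n - j) * (\<tau> ^ j * norm b)"
        by (subst jn) (simp only: power_add mult.assoc)
      also have "\<dots> \<le> c0 * \<tau> ^ (n - j) * norm ((T ^^ j) b)"
        using j(3) c0(1) \<tau> by (intro mult_left_mono) auto
      also have "\<dots> \<le> norm ((T ^^ (n - j)) ((T ^^ j) b))"
        using less.IH[of "n - j" "(T ^^ j) b"] j(2) 3 invn[OF less.prems] by simp
      also have "\<dots> = norm ((T ^^ n) b)"
        by (subst (2) jn) (simp only: funpow_add o_apply)
      finally show ?thesis .
    qed (simp)
  qed
  with c0(1) show ?thesis by blast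
qed

section \<open>Dominated splittings\<close>

text \<open>
  The range of the projection \<open>P\<close> is the slow invariant subspace. The kernel of \<open>P\<close> is an arbitrary
  complement, in general not invariant; on it the relevant dynamics is that of \<open>M\<close> followed by the
  projection, a model of \<open>M\<close> on the quotient by the slow subspace. The functions \<open>p\<close> and \<open>q\<close> are
  norms equivalent to the given one, adapted to the slow and to the fast part.
\<close>
locale dominated_splitting =
  fixes M P :: "'a::euclidean_space \<Rightarrow> 'a" and p q :: "'a \<Rightarrow> real" and \<rho> \<tau> C :: real
  assumes linear_M: "linear M" and linear_P: "linear P"
    and P_idem: "P (P z) = P z" and P_invariant: "P (M (P z)) = M (P z)"
    and p_triangle: "p (x + y) \<le> p x + p y" and p_ge: "norm z \<le> p z" and p_le: "p z \<le> C * norm z"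
    and q_triangle: "q (x + y) \<le> q x + q y" and q_ge: "norm z \<le> q z" and q_le: "q z \<le> C * norm z"
    and rates: "1 < \<rho>" "\<rho> < \<tau>"
    and p_step: "p (M (P z)) \<le> \<rho> * p (P z)"
    and q_step: "P b = 0 \<Longrightarrow> \<tau> * q b \<le> q (M b - P (M b))"

text \<open>
  Choose two rates \<open>\<sigma>\<^sub>1 < \<sigma>\<^sub>2\<close> with the same growth space \<open>V\<close> and place \<open>\<rho> < \<tau>\<close> between them. Growth
  at rate \<open>\<sigma>\<^sub>1\<close> on \<open>V\<close> gives the norm \<open>p\<close>. On a complement of \<open>V\<close> the projected map \<open>T\<close> has no nonzero orbit
  of growth \<open>\<sigma>\<^sub>2\<close>: adding up the parts in \<open>V\<close> that the projection discards, such an orbit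
  would come from an \<open>M\<close>-orbit of growth \<open>\<sigma>\<^sub>2\<close>, hence from a vector of \<open>V\<close>. So \<open>T\<close> expands uniformly, which
  gives \<open>q\<close>.
\<close>
lemma dominated_splitting_exists:
  fixes M :: "'a::euclidean_space \<Rightarrow> 'a"
  assumes lin: "linear M" and r: "1 < r"
  obtains P p q \<rho> \<tau> C where "dominated_splitting M P p q \<rho> \<tau> C" "\<rho> < r"
proof -
  obtain \<sigma>\<^sub>1 \<sigma>\<^sub>2 where \<sigma>: "1 < \<sigma>\<^sub>1" "\<sigma>\<^sub>1 < \<sigma>\<^sub>2" "\<sigma>\<^sub>2 < r" and V: "growth_space M \<sigma>\<^sub>1 = growth_space M \<sigma>\<^sub>2"
    using growth_space_gap[OF lin r] by blast
  define V where "V = growth_space M \<sigma>\<^sub>1"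
  obtain \<rho> where \<rho>: "\<sigma>\<^sub>1 < \<rho>" "\<rho> < \<sigma>\<^sub>2" using \<sigma> dense by blast
  obtain \<tau> where \<tau>: "\<rho> < \<tau>" "\<tau> < \<sigma>\<^sub>2" using \<rho> dense by blast
  have pos: "0 < \<sigma>\<^sub>1" "0 < \<sigma>\<^sub>2" "0 < \<rho>" "0 < \<tau>" using \<sigma> \<rho> \<tau> by auto
  have V_sub: "subspace V" unfolding V_def by (rule subspace_growth_space[OF lin])
  obtain P where P: "range P \<subseteq> V" "linear P" "\<And>v. v \<in> V \<Longrightarrow> P v = v"
    using linear_exists_left_inverse_on[OF linear_id V_sub] by (auto simp: inj_on_def)
  have PV: "P z \<in> V" for z using P(1) by auto
  have MV: "M v \<in> V" if "v \<in> V" for v using that growth_space_invariant by (auto simp: V_def)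
  have P_inv: "P (M (P z)) = M (P z)" for z by (intro P(3) MV PV)
  note P_lin = linear_add[OF P(2)] linear_diff[OF P(2)] linear_0[OF P(2)]
  note M_lin = linear_add[OF lin] linear_diff[OF lin] linear_0[OF lin]

  obtain C\<^sub>1 where C\<^sub>1: "\<And>n z. norm ((M ^^ n) (P z)) \<le> C\<^sub>1 * \<sigma>\<^sub>1 ^ n * norm z"
    using growth_space_uniform[OF lin P(2)] PV unfolding V_def by metis
  obtain N\<^sub>p where N\<^sub>p: "N\<^sub>p > 0" "C\<^sub>1 * \<sigma>\<^sub>1 ^ N\<^sub>p \<le> \<rho> ^ N\<^sub>p"
    using exponential_ratio[OF pos(1) \<rho>(1)] by blast
  define p where "p = adapted_norm M \<rho> N\<^sub>p"
  obtain C\<^sub>p where C\<^sub>p: "C\<^sub>p > 0" "\<And>z. p z \<le> C\<^sub>p * norm z"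
    using adapted_norm_bound[OF lin pos(3)] unfolding p_def by blast
  have p_tri: "p (x + y) \<le> p x + p y" for x y
    unfolding p_def by (rule adapted_norm_triangle[OF lin pos(3)])
  have p_ge: "norm z \<le> p z" for z unfolding p_def by (rule adapted_norm_ge[OF pos(3) N\<^sub>p(1)])
  have p_step: "p (M (P z)) \<le> \<rho> * p (P z)" for z
  proof -
    have "norm ((M ^^ N\<^sub>p) (P z)) \<le> \<rho> ^ N\<^sub>p * norm (P z)"
      using C\<^sub>1[of N\<^sub>p "P z"] mult_right_mono[OF N\<^sub>p(2) norm_ge_zero[of "P z"]] P(3)[OF PV] by simp
    then have "norm ((M ^^ N\<^sub>p) (P z)) / \<rho> ^ N\<^sub>p \<le> norm (P z)"
      using pos by (simp add: field_simps)
    then show ?thesis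
      unfolding p_def adapted_norm_step[OF pos(3)] using pos by (intro mult_left_mono) auto
  qed

  define S where "S = {b. P b = 0}"
  define T where "T z = M z - P (M z)" for z
  have S: "subspace S" unfolding S_def
    by (rule subspaceI) (simp_all add: P_lin linear_cmul[OF P(2)])
  have T_lin: "linear T"
    unfolding T_def
    by (intro linear_compose_sub lin linear_compose[OF lin P(2), unfolded o_def])
  have TS: "T z \<in> S" for z using P(3)[OF PV] by (simp add: S_def T_def P_lin)
  have T_unbdd: "b = 0" if b: "b \<in> S" and D: "\<And>n. norm ((T ^^ n) b) \<le> D * \<sigma>\<^sub>2 ^ n" for b D
  proof -
    \<comment> \<open>The part of the \<open>M\<close>-orbit inside \<open>V\<close>: it obeys a recursion contracting relative to \<open>\<sigma>\<^sub>2\<close>,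
      with inhomogeneity controlled by the \<open>T\<close>-orbit.\<close>
    define a where "a n = P ((M ^^ n) b)" for n
    have split: "(T ^^ n) b = (M ^^ n) b - a n" for n
    proof (induction n)
      case 0
      then show ?case using b by (simp add: a_def S_def)
    next
      case (Suc n)
      then show ?case by (simp add: T_def a_def P_lin M_lin P_inv)
    qed
    have "linear (\<lambda>z. P (M z))" using linear_compose[OF lin P(2)] by (simp add: o_def)
    then obtain c where c: "c > 0" "\<And>z. norm (P (M z)) \<le> c * norm z"
      using linear_bounded_pos by blast
    \<comment> \<open>The fixed point of the scaled recursion: \<open>\<rho> K + C\<^sub>p c D = \<sigma>\<^sub>2 K\<close>.\<close>
    define K where "K = C\<^sub>p * c * D / (\<sigma>\<^sub>2 - \<rho>)"
    have "0 \<le> D" using D[of 0] norm_ge_zero[of b] by (simp del: norm_ge_zero)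
    then have K0: "0 \<le> K" using C\<^sub>p(1) c(1) \<rho> by (simp add: K_def)
    have a_bound: "p (a n) \<le> K * \<sigma>\<^sub>2 ^ n" for n
    proof (induction n)
      case 0
      have "p (a 0) \<le> 0" using b C\<^sub>p(2)[of 0] by (simp add: a_def S_def)
      then show ?case using K0 by simp
    next
      case (Suc n)
      have "a (Suc n) = P (M (a n + (T ^^ n) b))" by (simp add: split) (simp add: a_def)
      also have "\<dots> = M (a n) + P (M ((T ^^ n) b))"
        by (simp add: P_lin M_lin) (simp add: a_def P_inv)
      finally have "p (a (Suc n)) \<le> p (M (a n)) + p (P (M ((T ^^ n) b)))"
        using p_tri by simp
      also have "\<dots> \<le> \<rho> * (K * \<sigma>\<^sub>2 ^ n) + C\<^sub>p * (c * (D * \<sigma>\<^sub>2 ^ n))"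
      proof (intro add_mono)
        have "p (M (a n)) \<le> \<rho> * p (a n)" using p_step by (simp add: a_def)
        also have "\<dots> \<le> \<rho> * (K * \<sigma>\<^sub>2 ^ n)" using Suc pos by (intro mult_left_mono) auto
        finally show "p (M (a n)) \<le> \<rho> * (K * \<sigma>\<^sub>2 ^ n)" .
        have "norm (P (M ((T ^^ n) b))) \<le> c * (D * \<sigma>\<^sub>2 ^ n)"
          using c(2)[of "(T ^^ n) b"] mult_left_mono[OF D[of n], of c] c(1) by linarith
        then show "p (P (M ((T ^^ n) b))) \<le> C\<^sub>p * (c * (D * \<sigma>\<^sub>2 ^ n))"
          using C\<^sub>p(2)[of "P (M ((T ^^ n) b))"] mult_left_mono[of _ _ C\<^sub>p] C\<^sub>p(1)
          by (meson less_imp_le order_trans)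
      qed
      also have "C\<^sub>p * (c * (D * \<sigma>\<^sub>2 ^ n)) = (\<sigma>\<^sub>2 - \<rho>) * K * \<sigma>\<^sub>2 ^ n"
        using \<rho> by (simp add: K_def)
      finally show ?case by (simp add: algebra_simps)
    qed
    have "b \<in> growth_space M \<sigma>\<^sub>2"
    proof (rule growth_spaceI)
      fix n
      have "norm ((M ^^ n) b) \<le> norm (a n) + norm ((T ^^ n) b)"
        using norm_triangle_ineq[of "a n" "(T ^^ n) b"] by (simp add: split)
      then show "norm ((M ^^ n) b) \<le> (K + D) * \<sigma>\<^sub>2 ^ n"
        using p_ge[of "a n"] a_bound[of n] D[of n] by (simp add: distrib_right)
    qed
    then have "P b = b" using P(3) V V_def by auto
    with b show "b = 0" by (simp add: S_def)
  qed
  have "\<exists>c>0. \<forall>n. \<forall>b\<in>S. c * \<sigma>\<^sub>2 ^ n * norm b \<le> norm ((T ^^ n) b)"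
  proof (rule uniform_expansion[OF T_lin S TS pos(2)])
    show "b = 0" if "b \<in> S" "\<And>n. norm ((T ^^ n) b) \<le> D * \<sigma>\<^sub>2 ^ n" for b D
      using that by (rule T_unbdd)
  qed
  then obtain c where c: "0 < c" "\<And>n b. b \<in> S \<Longrightarrow> c * \<sigma>\<^sub>2 ^ n * norm b \<le> norm ((T ^^ n) b)"
    by blast
  obtain N\<^sub>q where N\<^sub>q: "N\<^sub>q > 0" "1 / c * \<tau> ^ N\<^sub>q \<le> \<sigma>\<^sub>2 ^ N\<^sub>q"
    using exponential_ratio[OF pos(4) \<tau>(2)] by blast
  define q where "q = adapted_norm T \<tau> N\<^sub>q"
  obtain C\<^sub>q where C\<^sub>q: "C\<^sub>q > 0" "\<And>z. q z \<le> C\<^sub>q * norm z"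
    using adapted_norm_bound[OF T_lin pos(4)] unfolding q_def by blast
  have q_step: "\<tau> * q b \<le> q (T b)" if b: "P b = 0" for b
  proof -
    have "\<tau> ^ N\<^sub>q * norm b \<le> c * \<sigma>\<^sub>2 ^ N\<^sub>q * norm b"
      using N\<^sub>q(2) c(1) by (intro mult_right_mono) (auto simp: field_simps)
    also have "\<dots> \<le> norm ((T ^^ N\<^sub>q) b)" using c(2) b by (simp add: S_def)
    finally have "norm b \<le> norm ((T ^^ N\<^sub>q) b) / \<tau> ^ N\<^sub>q" using pos by (simp add: field_simps)
    then show ?thesis
      unfolding q_def adapted_norm_step[OF pos(4)] using pos by (intro mult_left_mono) auto
  qed

  have "dominated_splitting M P p q \<rho> \<tau> (max C\<^sub>p C\<^sub>q)"
  proof (rule dominated_splitting.intro)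
    show "p z \<le> max C\<^sub>p C\<^sub>q * norm z" for z
      using C\<^sub>p(2)[of z] mult_right_mono[of C\<^sub>p "max C\<^sub>p C\<^sub>q" "norm z"] by simp
    show "q z \<le> max C\<^sub>p C\<^sub>q * norm z" for z
      using C\<^sub>q(2)[of z] mult_right_mono[of C\<^sub>q "max C\<^sub>p C\<^sub>q" "norm z"] by simp
    show "q (x + y) \<le> q x + q y" for x y
      unfolding q_def by (rule adapted_norm_triangle[OF T_lin pos(4)])
    show "norm z \<le> q z" for z unfolding q_def by (rule adapted_norm_ge[OF pos(4) N\<^sub>q(1)])
    show "\<tau> * q b \<le> q (M b - P (M b))" if "P b = 0" for b
      using q_step[OF that] by (simp add: T_def)
  qed (use lin P PV P_inv p_tri p_ge p_step \<sigma> \<rho> \<tau> in auto)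
  moreover have "\<rho> < r" using \<rho> \<sigma> by simp
  ultimately show thesis using that by blast
qed

context dominated_splitting
begin

text \<open>
  On the slow subspace \<open>w \<bullet> (M ^^ n) v = m ^ n * (w \<bullet> v)\<close> can grow no faster than \<open>\<rho> ^ n\<close>, while \<open>\<bar>m\<bar> > \<rho>\<close>.
\<close>
lemma functional_vanishes:
  assumes w: "\<And>z. w \<bullet> M z = m * (w \<bullet> z)" and m: "\<rho> < \<bar>m\<bar>"
  shows "w \<bullet> P z = 0"
proof (rule ccontr)
  assume nz: "w \<bullet> P z \<noteq> 0"
  have "w \<bullet> (M ^^ n) v = m ^ n * (w \<bullet> v)" for n v
    by (induction n) (simp_all add: w)
  moreover have "p ((M ^^ n) (P z)) \<le> \<rho> ^ n * p (P z) \<and> P ((M ^^ n) (P z)) = (M ^^ n) (P z)" for n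
  proof (induction n)
    case (Suc n)
    have "p ((M ^^ Suc n) (P z)) \<le> \<rho> * p ((M ^^ n) (P z))"
      using Suc p_step[of "(M ^^ n) (P z)"] by simp
    also have "\<dots> \<le> \<rho> * (\<rho> ^ n * p (P z))" using Suc rates by (intro mult_left_mono) auto
    finally show ?case using Suc P_invariant[of "(M ^^ n) (P z)"] by simp
  qed (simp add: P_idem)
  ultimately have bound: "\<bar>m\<bar> ^ n * \<bar>w \<bullet> P z\<bar> \<le> norm w * (\<rho> ^ n * p (P z))" for n
  proof -
    assume eq: "\<And>n v. w \<bullet> (M ^^ n) v = m ^ n * (w \<bullet> v)"
      and le: "\<And>n. p ((M ^^ n) (P z)) \<le> \<rho> ^ n * p (P z) \<and> P ((M ^^ n) (P z)) = (M ^^ n) (P z)"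
    have "\<bar>m\<bar> ^ n * \<bar>w \<bullet> P z\<bar> = \<bar>w \<bullet> (M ^^ n) (P z)\<bar>" by (simp add: eq abs_mult power_abs)
    also have "\<dots> \<le> norm w * norm ((M ^^ n) (P z))" by (rule Cauchy_Schwarz_ineq2)
    also have "\<dots> \<le> norm w * (\<rho> ^ n * p (P z))"
      using le[of n] p_ge[of "(M ^^ n) (P z)"] by (intro mult_left_mono norm_ge_zero) linarith
    finally show ?thesis .
  qed
  obtain n where "norm w * p (P z) / \<bar>w \<bullet> P z\<bar> < (\<bar>m\<bar> / \<rho>) ^ n"
    using real_arch_pow[of "\<bar>m\<bar> / \<rho>" "norm w * p (P z) / \<bar>w \<bullet> P z\<bar>"] m rates by auto
  then have "norm w * (\<rho> ^ n * p (P z)) < \<bar>m\<bar> ^ n * \<bar>w \<bullet> P z\<bar>"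
    using nz rates by (simp add: field_simps power_divide)
  with bound[of n] show False by simp
qed

section \<open>Straightening the fast directions\<close>

definition Q :: "'a \<Rightarrow> 'a" where "Q z = z - P z"

definition T :: "'a \<Rightarrow> 'a" where "T z = Q (M z)"

lemma linear_Q: "linear Q"
  unfolding Q_def by (intro linear_compose_sub linear_P linear_id[unfolded id_def])

lemma linear_T: "linear T"
  unfolding T_def using linear_compose[OF linear_M linear_Q] by (simp add: o_def)

lemmas P_simps = linear_add[OF linear_P] linear_diff[OF linear_P] linear_0[OF linear_P] P_idem
lemmas M_simps = linear_add[OF linear_M] linear_diff[OF linear_M] linear_0[OF linear_M]
lemmas Q_simps = linear_add[OF linear_Q] linear_diff[OF linear_Q] linear_0[OF linear_Q]

lemma P_Q [simp]: "P (Q z) = 0" by (simp add: Q_def P_simps)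

lemma P_add_Q: "P z + Q z = z" by (simp add: Q_def)

lemma Q_eq_self: "P b = 0 \<Longrightarrow> Q b = b" by (simp add: Q_def)

lemma T_Q: "T (Q z) = T z"
  by (simp add: T_def Q_def P_simps M_simps P_invariant)

lemma T_step: "P b = 0 \<Longrightarrow> \<tau> * q b \<le> q (T b)"
  using q_step by (simp add: T_def Q_def)

lemma q_zero: "q b = 0 \<Longrightarrow> b = 0"
  using q_ge[of b] by simp

lemma zero_norms [simp]: "p 0 = 0" "q 0 = 0"
  using p_ge[of 0] p_le[of 0] q_ge[of 0] q_le[of 0] by auto

lemma q_nonneg: "0 \<le> q z" using q_ge[of z] norm_ge_zero[of z] by linarith

lemma C_ge_1: "1 \<le> C"
proof -
  obtain i :: 'a where "i \<in> Basis" using nonempty_Basis by blast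
  then show ?thesis using p_ge[of i] p_le[of i] by simp
qed

text \<open>
  \<open>T\<close> is injective on the kernel of \<open>P\<close>, hence bijective there; precomposing the inverse with \<open>Q\<close> extends it
  to the whole space.
\<close>
lemma T_inverse_exists:
  "\<exists>U. linear U \<and> (\<forall>z. P (U z) = 0 \<and> T (U z) = Q z \<and> \<tau> * q (U z) \<le> q (Q z))"
proof -
  define S where "S = {b. P b = 0}"
  have S: "subspace S" unfolding S_def
    by (rule subspaceI) (simp_all add: P_simps linear_cmul[OF linear_P])
  have T0: "b = 0" if "b \<in> S" "T b = 0" for b
  proof -
    have "\<tau> * q b \<le> 0" using T_step[of b] that by (simp add: S_def)
    then have "q b \<le> 0" using rates by (simp add: mult_le_0_iff)
    then show ?thesis using q_nonneg[of b] q_zero by simp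
  qed
  have inj: "inj_on T S"
    using linear_inj_on_iff_eq_0[OF linear_T S] T0 by blast
  then obtain U0 where U0: "range U0 \<subseteq> S" "linear U0" "\<And>b. b \<in> S \<Longrightarrow> U0 (T b) = b"
    using linear_exists_left_inverse_on[OF linear_T S] by blast
  have "T ` S = S"
  proof (rule subspace_dim_equal)
    show "subspace (T ` S)" by (rule linear_subspace_image[OF linear_T S])
    show "T ` S \<subseteq> S" by (auto simp: S_def T_def)
    show "dim S \<le> dim (T ` S)"
      using dim_image_eq[OF linear_T, of S] inj S by (simp add: span_eq_iff[THEN iffD2])
  qed (rule S)
  then have TU0: "T (U0 b) = b" if "b \<in> S" for b
    using that U0(3) by (metis imageE)
  define U where "U z = U0 (Q z)" for z
  have "linear U"
    unfolding U_def using linear_compose[OF linear_Q U0(2)] by (simp add: o_def)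
  moreover have PU: "P (U z) = 0" for z using U0(1) by (auto simp: U_def S_def)
  moreover have TU: "T (U z) = Q z" for z unfolding U_def by (rule TU0) (simp add: S_def)
  moreover have "\<tau> * q (U z) \<le> q (Q z)" for z using T_step[OF PU, of z] by (simp add: TU)
  ultimately show ?thesis by blast
qed

text \<open>
  The equation for \<open>h\<close> is solved by iterating \<open>h = U (Q G + h \<circ> f)\<close> with \<open>U\<close> the inverse of \<open>T\<close>, that is, by
  \<open>h = (\<Sum>n. U ^ (n + 1) (G \<circ> f ^ n))\<close>. The series converges uniformly because \<open>U\<close> contracts \<open>q\<close> by
  \<open>1 / \<tau>\<close>. Only the forward orbit of \<open>z\<close> enters, and \<open>f\<close> maps cosets of \<open>\<Lambda>\<close> to cosets of \<open>\<Lambda>\<close>, so \<open>h\<close>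
  inherits the periodicity of \<open>G\<close>.
\<close>
lemma semiconjugacy:
  fixes G :: "'a \<Rightarrow> 'a" and \<Lambda> :: "'a set"
  assumes cont: "continuous_on UNIV G" and bdd: "bounded (range G)"
    and periodic: "\<And>z l. l \<in> \<Lambda> \<Longrightarrow> G (z + l) = G z" and lattice: "\<And>l. l \<in> \<Lambda> \<Longrightarrow> M l \<in> \<Lambda>"
  obtains h where "continuous_on UNIV h" "bounded (range h)" "\<And>z l. l \<in> \<Lambda> \<Longrightarrow> h (z + l) = h z"
    "\<And>z. P (h z) = 0" "\<And>z. T (h z) = Q (G z) + h (M z + G z)"
proof -
  obtain U where U: "linear U" "\<And>z. P (U z) = 0" "\<And>z. T (U z) = Q z" "\<And>z. \<tau> * q (U z) \<le> q (Q z)"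
    using T_inverse_exists by blast
  define f where "f z = M z + G z" for z
  define s where "s n z = (U ^^ Suc n) (G ((f ^^ n) z))" for n z
  have U_lin: "linear (U ^^ n)" for n using U(1) by (rule linear_funpow)
  obtain B where B: "\<And>z. norm (G z) \<le> B" using bdd by (auto simp: bounded_iff)
  obtain c where c: "c > 0" "\<And>z. norm (Q z) \<le> c * norm z"
    using linear_bounded_pos[OF linear_Q] by blast
  have C0: "C \<ge> 0" using C_ge_1 by simp
  have U_bound: "q ((U ^^ Suc n) z) \<le> C * c * norm z * (1 / \<tau>) ^ n" for n z
  proof (induction n)
    case 0
    have "1 * q (U z) \<le> \<tau> * q (U z)" using rates by (intro mult_right_mono q_nonneg) auto
    also have "\<dots> \<le> q (Q z)" by (rule U(4))
    also have "\<dots> \<le> C * (c * norm z)"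
      using q_le[of "Q z"] mult_left_mono[OF c(2) C0] by (rule order_trans)
    finally show ?case by simp
  next
    case (Suc n)
    have "\<tau> * q ((U ^^ Suc (Suc n)) z) \<le> q (Q ((U ^^ Suc n) z))"
      using U(4)[of "(U ^^ Suc n) z"] by simp
    also have "Q ((U ^^ Suc n) z) = (U ^^ Suc n) z" by (rule Q_eq_self) (simp add: U(2))
    finally have "q ((U ^^ Suc (Suc n)) z) \<le> q ((U ^^ Suc n) z) * (1 / \<tau>)"
      using rates by (simp add: field_simps)
    also have "\<dots> \<le> C * c * norm z * (1 / \<tau>) ^ n * (1 / \<tau>)"
      using Suc rates by (intro mult_right_mono) auto
    finally show ?case by simp
  qed
  have s_bound: "norm (s n z) \<le> C * c * B * (1 / \<tau>) ^ n" for n z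
  proof -
    have "norm (s n z) \<le> C * c * norm (G ((f ^^ n) z)) * (1 / \<tau>) ^ n"
      unfolding s_def using q_ge U_bound by (rule order_trans)
    also have "\<dots> \<le> C * c * B * (1 / \<tau>) ^ n"
      using B C0 c rates by (intro mult_right_mono mult_left_mono) auto
    finally show ?thesis .
  qed
  have geo: "summable (\<lambda>n. C * c * B * (1 / \<tau>) ^ n)"
    using rates by (intro summable_mult summable_geometric) auto
  have s_sum: "summable (\<lambda>n. s n z)" for z
    using summable_comparison_test'[OF geo, of 0 "\<lambda>n. s n z"] s_bound by auto
  define h where "h z = (\<Sum>n. s n z)" for z
  have f_cont: "continuous_on UNIV f"
    unfolding f_def using linear_M cont
    by (intro continuous_intros) (auto simp: linear_conv_bounded_linear intro: linear_continuous_on)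
  have fn_cont: "continuous_on UNIV (f ^^ n)" for n
  proof (induction n)
    case (Suc n)
    then show ?case
      using continuous_on_compose[OF Suc continuous_on_subset[OF f_cont]] by simp
  qed (simp add: continuous_on_id id_def)
  have s_cont: "continuous_on UNIV (s n)" for n
  proof -
    have "continuous_on UNIV (\<lambda>z. G ((f ^^ n) z))"
      using continuous_on_compose[OF fn_cont continuous_on_subset[OF cont]] by (simp add: o_def)
    moreover have "continuous_on UNIV (U ^^ Suc n)"
      by (rule linear_continuous_on) (use U_lin linear_conv_bounded_linear in blast)
    ultimately show ?thesis
      unfolding s_def using continuous_on_compose2[of UNIV "U ^^ Suc n" UNIV] by blast
  qed
  have "uniform_limit UNIV (\<lambda>N z. \<Sum>n<N. s n z) h sequentially"
    unfolding h_def by (rule Weierstrass_m_test[OF _ geo]) (use s_bound in auto)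
  then have h_cont: "continuous_on UNIV h"
    by (rule uniform_limit_theorem[rotated]) (auto intro!: always_eventually continuous_on_sum s_cont)
  have h_bdd: "norm (h z) \<le> (\<Sum>n. C * c * B * (1 / \<tau>) ^ n)" for z
    unfolding h_def by (rule norm_suminf_le[OF s_bound geo])
  have T_bl: "bounded_linear T" and P_bl: "bounded_linear P"
    using linear_T linear_P by (auto simp: linear_conv_bounded_linear)
  have h_P: "P (h z) = 0" for z
    unfolding h_def bounded_linear.suminf[OF P_bl s_sum] by (simp add: s_def U(2))
  have h_eq: "T (h z) = Q (G z) + h (f z)" for z
  proof -
    have Ts: "T (s (Suc n) z) = s n (f z)" for n
    proof -
      have "s (Suc n) z = U (s n (f z))" by (simp add: s_def funpow_swap1[of f, symmetric])
      moreover have "P (s n (f z)) = 0" by (simp add: s_def U(2))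
      ultimately show ?thesis by (simp add: U(3) Q_eq_self)
    qed
    have "T (h z) = (\<Sum>n. T (s n z))"
      unfolding h_def by (rule bounded_linear.suminf[OF T_bl s_sum])
    also have "\<dots> = (\<Sum>n. T (s (Suc n) z)) + T (s 0 z)"
      using suminf_split_head[OF bounded_linear.summable[OF T_bl s_sum[of z]]] by simp
    also have "\<dots> = h (f z) + Q (G z)"
      unfolding Ts by (simp add: h_def s_def U(3))
    finally show ?thesis by simp
  qed
  have f_periodic: "\<exists>l'\<in>\<Lambda>. (f ^^ n) (z + l) = (f ^^ n) z + l'" if "l \<in> \<Lambda>" for n z l
  proof (induction n)
    case (Suc n)
    then obtain l' where l': "l' \<in> \<Lambda>" "(f ^^ n) (z + l) = (f ^^ n) z + l'" by blast
    then have "(f ^^ Suc n) (z + l) = (f ^^ Suc n) z + M l'"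
      by (simp add: f_def M_simps periodic)
    then show ?case using lattice[OF l'(1)] by blast
  qed (use that in auto)
  have s_periodic: "s n (z + l) = s n z" if "l \<in> \<Lambda>" for n z l
    using f_periodic[OF that, of n z] periodic by (auto simp: s_def)
  show thesis
  proof
    show "continuous_on UNIV h" by (rule h_cont)
    show "bounded (range h)" using h_bdd by (auto simp: bounded_iff)
    show "h (z + l) = h z" if "l \<in> \<Lambda>" for z l unfolding h_def s_periodic[OF that] ..
    show "P (h z) = 0" for z by (rule h_P)
    show "T (h z) = Q (G z) + h (M z + G z)" for z using h_eq by (simp add: f_def)
  qed
qed

text \<open>
  Suppose \<open>x + h x = y + h y\<close>. The difference \<open>\<Delta> n\<close> of the two orbits starts in
  the kernel of \<open>P\<close>. The cone \<open>p (P z) \<le> L * q (Q z)\<close> is invariant under \<open>M\<close>, because the fast part grows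
  at rate \<open>\<tau>\<close> and the slow part only at rate \<open>\<rho> < \<tau>\<close>, up to a drift from the fast part that
  a large \<open>L\<close> absorbs; this survives a perturbation with small Lipschitz constant. Inside
  the cone the fast part grows at least at rate \<open>\<rho> > 1\<close>. But the fast parts of \<open>z + h z\<close> at the two
  orbits agree for ever, so the fast part of \<open>\<Delta> n\<close> is bounded by twice the supremum of \<open>h\<close>, and
  must vanish.
\<close>
lemma injectivity_scale:
  obtains \<epsilon> where "\<epsilon> > 0"
    "\<And>(G::'a \<Rightarrow> 'a) h x y. (\<And>x y. norm (G x - G y) \<le> \<epsilon> * norm (x - y)) \<Longrightarrow> bounded (range h) \<Longrightarrow>
      (\<And>z. P (h z) = 0) \<Longrightarrow> (\<And>z. T (h z) = Q (G z) + h (M z + G z)) \<Longrightarrow> x + h x = y + h y \<Longrightarrow> x = y"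
proof -
  have PMQ: "linear (\<lambda>z. P (M z))" using linear_compose[OF linear_M linear_P] by (simp add: o_def)
  obtain c\<^sub>1 where c1: "c\<^sub>1 > 0" "\<And>z. norm (P (M z)) \<le> c\<^sub>1 * norm z"
    using linear_bounded_pos[OF PMQ] by blast
  obtain c\<^sub>P where cP: "c\<^sub>P > 0" "\<And>z. norm (P z) \<le> c\<^sub>P * norm z"
    using linear_bounded_pos[OF linear_P] by blast
  obtain c\<^sub>Q where cQ: "c\<^sub>Q > 0" "\<And>z. norm (Q z) \<le> c\<^sub>Q * norm z"
    using linear_bounded_pos[OF linear_Q] by blast
  have C: "C > 0" "\<And>z. p z \<le> C * norm z" "\<And>z. q z \<le> C * norm z"
    using C_ge_1 p_le q_le by auto
  define \<gamma> where "\<gamma> = \<tau> - \<rho>"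
  define D where "D = C * (c\<^sub>P + c\<^sub>Q)"
  \<comment> \<open>\<open>L\<close> solves \<open>\<rho> L + C c\<^sub>1 + \<gamma> = \<tau> L\<close>: the gap \<open>\<gamma>\<close> is left over for the perturbation. With \<open>\<eta>\<close> below,
    the perturbation costs \<open>\<eta>\<close> in the slow and \<open>L \<eta>\<close> in the fast part, and \<open>\<epsilon>\<close> is chosen so that
    these add up to exactly \<open>\<gamma>\<close>.\<close>
  define L where "L = C * c\<^sub>1 / \<gamma> + 1"
  define \<epsilon> where "\<epsilon> = \<gamma> / (D * (L + 1)\<^sup>2)"
  have \<gamma>: "\<gamma> > 0" using rates by (simp add: \<gamma>_def)
  have D: "D > 0" using C cP cQ by (simp add: D_def)
  have L: "L \<ge> 1" using C c1 \<gamma> by (simp add: L_def)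
  have \<epsilon>: "\<epsilon> > 0" using \<gamma> D L by (simp add: \<epsilon>_def)
  define \<eta> where "\<eta> = D * \<epsilon> * (L + 1)"
  have \<eta>_eq: "\<eta> * (L + 1) = \<gamma>" using D L by (simp add: \<eta>_def \<epsilon>_def power2_eq_square)
  have \<eta>0: "\<eta> > 0" using D \<epsilon> L by (simp add: \<eta>_def)
  have \<eta>: "\<eta> \<le> \<gamma>" using mult_left_mono[of 1 "L + 1" \<eta>] \<eta>0 L \<eta>_eq by simp
  have L_\<gamma>: "L * \<gamma> = C * c\<^sub>1 + \<gamma>" using \<gamma> by (simp add: L_def field_simps)
  have inj: "x = y" if lip: "\<And>x y. norm (G x - G y) \<le> \<epsilon> * norm (x - y)" and bdd: "bounded (range h)"
    and hP: "\<And>z. P (h z) = 0" and h_eq: "\<And>z. T (h z) = Q (G z) + h (M z + G z)"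
    and K: "x + h x = y + h y" for G h x y
  proof -
    define f where "f z = M z + G z" for z
    define \<Delta> where "\<Delta> n = (f ^^ n) x - (f ^^ n) y" for n
    define g where "g n = G ((f ^^ n) x) - G ((f ^^ n) y)" for n
    have \<Delta>_Suc: "\<Delta> (Suc n) = M (\<Delta> n) + g n" for n
      by (simp add: \<Delta>_def g_def f_def M_simps)
    \<comment> \<open>The fast part of \<open>z + h z\<close> evolves by \<open>T\<close> alone, so it agrees along both orbits.\<close>
    have QK: "Q (f z) + h (f z) = T (z + h z)" for z
    proof -
      have "T (z + h z) = Q (M z) + (Q (G z) + h (f z))"
        using h_eq by (simp add: linear_add[OF linear_T] f_def) (simp add: T_def)
      then show ?thesis by (simp add: f_def Q_simps)
    qed
    have QKn: "Q ((f ^^ n) x) + h ((f ^^ n) x) = Q ((f ^^ n) y) + h ((f ^^ n) y)" for n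
    proof (induction n)
      case 0
      have "Q (x + h x) = Q (y + h y)" using K by simp
      then show ?case by (simp add: Q_simps Q_eq_self hP)
    next
      case (Suc n)
      have eq: "T (z + h z) = T (Q z + h z)" for z
        using T_Q[of "z + h z"] by (simp add: Q_simps Q_eq_self hP)
      have "Q ((f ^^ Suc n) z) + h ((f ^^ Suc n) z) = T (Q ((f ^^ n) z) + h ((f ^^ n) z))" for z
        using QK[of "(f ^^ n) z"] eq[of "(f ^^ n) z"] by simp
      with Suc show ?case by simp
    qed
    have g_bound: "norm (g n) \<le> \<epsilon> * (p (P (\<Delta> n)) + q (Q (\<Delta> n)))" for n
    proof -
      have "norm (\<Delta> n) \<le> norm (P (\<Delta> n)) + norm (Q (\<Delta> n))"
        using norm_triangle_ineq[of "P (\<Delta> n)" "Q (\<Delta> n)"] by (simp add: P_add_Q)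
      also have "\<dots> \<le> p (P (\<Delta> n)) + q (Q (\<Delta> n))" by (intro add_mono p_ge q_ge)
      finally have "\<epsilon> * norm (\<Delta> n) \<le> \<epsilon> * (p (P (\<Delta> n)) + q (Q (\<Delta> n)))"
        using \<epsilon> by (intro mult_left_mono) auto
      then show ?thesis using lip[of "(f ^^ n) x" "(f ^^ n) y"] by (simp add: g_def \<Delta>_def)
    qed
    have q_grow: "\<rho> * q (Q (\<Delta> n)) \<le> q (Q (\<Delta> (Suc n))) \<and> p (P (\<Delta> (Suc n))) \<le> L * q (Q (\<Delta> (Suc n)))"
      if cone: "p (P (\<Delta> n)) \<le> L * q (Q (\<Delta> n))" for n
    proof -
      let ?b = "Q (\<Delta> n)" and ?a = "P (\<Delta> n)"
      have "norm (g n) \<le> \<epsilon> * (L + 1) * q ?b"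
        using order_trans[OF g_bound[of n] mult_left_mono[OF add_right_mono[OF cone], of \<epsilon> "q ?b"]] \<epsilon>
        by (simp add: algebra_simps)
      then have gn: "D * norm (g n) \<le> \<eta> * q ?b"
        using mult_left_mono[of _ _ D] D unfolding \<eta>_def by (simp add: mult.assoc)
      have "C * norm (P (g n)) \<le> C * (c\<^sub>P * norm (g n))"
        using C(1) cP(2) by (intro mult_left_mono) auto
      also have "\<dots> \<le> D * norm (g n)"
        using C cP cQ by (simp add: D_def distrib_left distrib_right mult.assoc)
      finally have pg: "p (P (g n)) \<le> \<eta> * q ?b" using C(2)[of "P (g n)"] gn by linarith
      have "C * norm (Q (g n)) \<le> C * (c\<^sub>Q * norm (g n))"
        using C(1) cQ(2) by (intro mult_left_mono) auto
      also have "\<dots> \<le> D * norm (g n)"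
        using C cP cQ by (simp add: D_def distrib_left distrib_right mult.assoc)
      finally have qg: "q (- Q (g n)) \<le> \<eta> * q ?b" using C(3)[of "- Q (g n)"] gn by simp
      have b_eq: "Q (\<Delta> (Suc n)) = T ?b + Q (g n)"
        by (simp add: \<Delta>_Suc Q_simps T_Q) (simp add: T_def)
      have "\<tau> * q ?b \<le> q (T ?b)" by (rule T_step) simp
      also have "\<dots> \<le> q (Q (\<Delta> (Suc n))) + q (- Q (g n))"
        using q_triangle[of "Q (\<Delta> (Suc n))" "- Q (g n)"] by (simp add: b_eq)
      finally have low: "(\<tau> - \<eta>) * q ?b \<le> q (Q (\<Delta> (Suc n)))" using qg by (simp add: algebra_simps)
      have "P (\<Delta> (Suc n)) = M ?a + P (M ?b) + P (g n)"
      proof -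
        have "P (M (\<Delta> n)) = P (M (?a + ?b))" by (simp only: P_add_Q)
        then show ?thesis by (simp add: \<Delta>_Suc P_simps M_simps P_invariant)
      qed
      then have "p (P (\<Delta> (Suc n))) \<le> p (M ?a) + p (P (M ?b)) + p (P (g n))"
        using p_triangle[of "M ?a + P (M ?b)" "P (g n)"] p_triangle[of "M ?a" "P (M ?b)"] by simp
      moreover have "p (M ?a) \<le> \<rho> * (L * q ?b)"
        using p_step[of "\<Delta> n"] mult_left_mono[OF cone, of \<rho>] rates by linarith
      moreover have "p (P (M ?b)) \<le> C * c\<^sub>1 * q ?b"
      proof -
        have "p (P (M ?b)) \<le> C * norm (P (M ?b))" by (rule C)
        also have "\<dots> \<le> C * (c\<^sub>1 * norm ?b)" using C c1 by (intro mult_left_mono) auto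
        also have "\<dots> \<le> C * (c\<^sub>1 * q ?b)" using C c1 by (intro mult_left_mono q_ge) auto
        finally show ?thesis by simp
      qed
      ultimately have "p (P (\<Delta> (Suc n))) \<le> (\<rho> * L + C * c\<^sub>1 + \<eta>) * q ?b"
        using pg by (simp add: algebra_simps)
      also have "\<rho> * L + C * c\<^sub>1 + \<eta> = L * (\<tau> - \<eta>)"
        using L_\<gamma> \<eta>_eq by (simp add: \<gamma>_def algebra_simps)
      also have "L * (\<tau> - \<eta>) * q ?b \<le> L * q (Q (\<Delta> (Suc n)))"
        using mult_left_mono[OF low, of L] L by (simp add: mult.assoc)
      finally have "p (P (\<Delta> (Suc n))) \<le> L * q (Q (\<Delta> (Suc n)))" .
      moreover have "\<rho> * q ?b \<le> (\<tau> - \<eta>) * q ?b"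
        using \<eta> q_nonneg by (intro mult_right_mono) (auto simp: \<gamma>_def)
      ultimately show ?thesis using low by linarith
    qed
    have P0: "P (\<Delta> 0) = 0"
    proof -
      have "x - y = h y - h x" using K by (simp add: algebra_simps)
      then show ?thesis by (simp add: \<Delta>_def P_simps hP)
    qed
    have cone: "p (P (\<Delta> n)) \<le> L * q (Q (\<Delta> n))" for n
      by (induction n) (use P0 L q_nonneg q_grow in auto)
    have grow: "\<rho> ^ n * q (Q (\<Delta> 0)) \<le> q (Q (\<Delta> n))" for n
    proof (induction n)
      case (Suc n)
      have "\<rho> ^ Suc n * q (Q (\<Delta> 0)) \<le> \<rho> * q (Q (\<Delta> n))"
        using mult_left_mono[OF Suc, of \<rho>] rates by (simp add: mult.assoc)
      then show ?case using q_grow[OF cone, of n] by linarith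
    qed simp
    obtain B where B: "\<And>z. norm (h z) \<le> B" using bdd by (auto simp: bounded_iff)
    have "q (Q (\<Delta> n)) \<le> C * (2 * B)" for n
    proof -
      have "Q (\<Delta> n) = h ((f ^^ n) y) - h ((f ^^ n) x)"
        using QKn[of n] by (simp add: \<Delta>_def Q_simps algebra_simps)
      then have "norm (Q (\<Delta> n)) \<le> 2 * B"
        using norm_triangle_ineq4[of "h ((f ^^ n) y)" "h ((f ^^ n) x)"]
          B[of "(f ^^ n) y"] B[of "(f ^^ n) x"] by simp
      then show ?thesis
        using C(3)[of "Q (\<Delta> n)"] mult_left_mono[of _ _ C] C(1) by (meson less_imp_le order_trans)
    qed
    then have bound: "\<rho> ^ n * q (Q (\<Delta> 0)) \<le> C * (2 * B)" for n using grow order_trans by blast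
    have "q (Q (\<Delta> 0)) = 0"
    proof (rule ccontr)
      assume "q (Q (\<Delta> 0)) \<noteq> 0"
      then have pos: "q (Q (\<Delta> 0)) > 0" using q_nonneg[of "Q (\<Delta> 0)"] by simp
      obtain n where "C * (2 * B) / q (Q (\<Delta> 0)) < \<rho> ^ n" using real_arch_pow[OF rates(1)] by blast
      then show False using bound[of n] pos by (simp add: field_simps)
    qed
    then have "\<Delta> 0 = 0" using P0 P_add_Q[of "\<Delta> 0"] q_zero by simp
    then show "x = y" by (simp add: \<Delta>_def)
  qed
  show thesis by (rule that[OF \<epsilon> inj])
qed

end

text \<open>
  The equation \<open>z + h z = c\<close> says that \<open>z\<close> is a fixed point of \<open>c - h z\<close>, which maps a ball around \<open>c\<close> into
  itself.
\<close>
lemma surj_bounded_perturbation: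
  fixes h :: "'a::euclidean_space \<Rightarrow> 'a"
  assumes cont: "continuous_on UNIV h" and bdd: "bounded (range h)"
  shows "surj (\<lambda>z. z + h z)"
unfolding surj_def
proof
  fix c
  obtain B where B: "0 < B" "\<And>z. norm (h z) \<le> B"
    using bdd by (auto simp: bounded_pos)
  obtain z where "z \<in> cball c B" "c - h z = z"
  proof (rule brouwer_ball[of B c "\<lambda>z. c - h z"])
    show "continuous_on (cball c B) (\<lambda>z. c - h z)"
      by (intro continuous_intros continuous_on_subset[OF cont]) auto
    show "(\<lambda>z. c - h z) \<in> cball c B \<rightarrow> cball c B"
      using B(2) by (auto simp: dist_norm)
  qed (use B(1) in auto)
  then have "c = z + h z" by (simp add: algebra_simps)
  then show "\<exists>z. c = z + h z" by blast
qed

context dominated_splitting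
begin

lemma straightening_homeomorphism:
  obtains \<epsilon> where "\<epsilon> > 0"
    "\<And>(G::'a \<Rightarrow> 'a) \<Lambda>. continuous_on UNIV G \<Longrightarrow> bounded (range G) \<Longrightarrow>
      (\<And>x y. norm (G x - G y) \<le> \<epsilon> * norm (x - y)) \<Longrightarrow>
      (\<And>z l. l \<in> \<Lambda> \<Longrightarrow> G (z + l) = G z) \<Longrightarrow> (\<And>l. l \<in> \<Lambda> \<Longrightarrow> M l \<in> \<Lambda>) \<Longrightarrow>
      \<exists>K K'. homeomorphism UNIV UNIV K K' \<and> (\<forall>z. \<forall>l\<in>\<Lambda>. K (z + l) = K z + l) \<and>
        (\<forall>z. Q (K (M z + G z)) = Q (M (K z)))"
proof -
  obtain \<epsilon> where \<epsilon>: "\<epsilon> > 0" and inj: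
    "\<And>(G::'a \<Rightarrow> 'a) h x y. (\<And>x y. norm (G x - G y) \<le> \<epsilon> * norm (x - y)) \<Longrightarrow> bounded (range h) \<Longrightarrow>
      (\<And>z. P (h z) = 0) \<Longrightarrow> (\<And>z. T (h z) = Q (G z) + h (M z + G z)) \<Longrightarrow> x + h x = y + h y \<Longrightarrow> x = y"
    using injectivity_scale by metis
  have "\<exists>K K'. homeomorphism UNIV UNIV K K' \<and> (\<forall>z. \<forall>l\<in>\<Lambda>. K (z + l) = K z + l) \<and>
      (\<forall>z. Q (K (M z + G z)) = Q (M (K z)))"
    if G: "continuous_on UNIV G" "bounded (range G)"
      and lip: "\<And>x y. norm (G x - G y) \<le> \<epsilon> * norm (x - y)"
      and per: "\<And>z l. l \<in> \<Lambda> \<Longrightarrow> G (z + l) = G z" "\<And>l. l \<in> \<Lambda> \<Longrightarrow> M l \<in> \<Lambda>" for G :: "'a \<Rightarrow> 'a" and \<Lambda>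
  proof -
    obtain h where h: "continuous_on UNIV h" "bounded (range h)" "\<And>z l. l \<in> \<Lambda> \<Longrightarrow> h (z + l) = h z"
      "\<And>z. P (h z) = 0" "\<And>z. T (h z) = Q (G z) + h (M z + G z)"
      using semiconjugacy[of G \<Lambda>] G per by metis
    define K where "K z = z + h z" for z
    have "continuous_on UNIV K" unfolding K_def by (intro continuous_intros h(1))
    moreover have "inj K"
      unfolding K_def by (rule injI, rule inj[OF lip h(2,4,5)])
    moreover have "surj K"
      using surj_bounded_perturbation[OF h(1,2)] by (simp add: K_def[abs_def])
    ultimately obtain K' where "homeomorphism UNIV UNIV K K'"
      using invariance_of_domain_homeomorphism[of UNIV K] by auto
    moreover have "K (z + l) = K z + l" if "l \<in> \<Lambda>" for z l
      using h(3)[OF that] by (simp add: K_def)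
    moreover have "Q (K (M z + G z)) = Q (M (K z))" for z
    proof -
      have "Q (K (M z + G z)) = Q (M z) + (Q (G z) + h (M z + G z))"
        by (simp add: K_def Q_simps Q_eq_self h(4))
      also have "\<dots> = Q (M z) + T (h z)" by (simp add: h(5))
      also have "\<dots> = Q (M (K z))" by (simp add: K_def T_def Q_simps M_simps)
      finally show ?thesis .
    qed
    ultimately show ?thesis by blast
  qed
  with \<epsilon> show thesis by (intro that[of \<epsilon>]) auto
qed

end

text \<open>
  Since \<open>w\<close> vanishes on the slow subspace, it factors through \<open>Q\<close> and turns the equation for the fast part of
  \<open>K\<close> into one for \<open>w\<close>. The size
  \<open>\<epsilon>\<close> of the admissible perturbations does not depend on \<open>G\<close> or on the lattice \<open>\<Lambda>\<close> of periods.
\<close>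
lemma straightening:
  fixes M :: "'a::euclidean_space \<Rightarrow> 'a"
  assumes M: "linear M" and w: "\<And>z. w \<bullet> M z = m * (w \<bullet> z)" and m: "1 < \<bar>m\<bar>"
  obtains \<epsilon> where "\<epsilon> > 0"
    "\<And>(G::'a \<Rightarrow> 'a) \<Lambda>. continuous_on UNIV G \<Longrightarrow> bounded (range G) \<Longrightarrow>
      (\<And>x y. norm (G x - G y) \<le> \<epsilon> * norm (x - y)) \<Longrightarrow>
      (\<And>z l. l \<in> \<Lambda> \<Longrightarrow> G (z + l) = G z) \<Longrightarrow> (\<And>l. l \<in> \<Lambda> \<Longrightarrow> M l \<in> \<Lambda>) \<Longrightarrow>
      \<exists>K K'. homeomorphism UNIV UNIV K K' \<and> (\<forall>z. \<forall>l\<in>\<Lambda>. K (z + l) = K z + l) \<and>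
        (\<forall>z. w \<bullet> K (M z + G z) = m * (w \<bullet> K z))"
proof -
  obtain P p q \<rho> \<tau> C where D: "dominated_splitting M P p q \<rho> \<tau> C" and \<rho>: "\<rho> < \<bar>m\<bar>"
    using dominated_splitting_exists[OF M m] by blast
  interpret dominated_splitting M P p q \<rho> \<tau> C by (rule D)
  have wQ: "w \<bullet> Q z = w \<bullet> z" for z
    using functional_vanishes[OF w \<rho>, of z] by (simp add: Q_def inner_diff_right)
  obtain \<epsilon> where \<epsilon>: "\<epsilon> > 0" and K:
    "\<And>(G::'a \<Rightarrow> 'a) \<Lambda>. continuous_on UNIV G \<Longrightarrow> bounded (range G) \<Longrightarrow>
      (\<And>x y. norm (G x - G y) \<le> \<epsilon> * norm (x - y)) \<Longrightarrow>
      (\<And>z l. l \<in> \<Lambda> \<Longrightarrow> G (z + l) = G z) \<Longrightarrow> (\<And>l. l \<in> \<Lambda> \<Longrightarrow> M l \<in> \<Lambda>) \<Longrightarrow>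
      \<exists>K K'. homeomorphism UNIV UNIV K K' \<and> (\<forall>z. \<forall>l\<in>\<Lambda>. K (z + l) = K z + l) \<and>
        (\<forall>z. Q (K (M z + G z)) = Q (M (K z)))"
    using straightening_homeomorphism by metis
  have "w \<bullet> x = m * (w \<bullet> y)" if "Q x = Q (M y)" for x y
    using wQ[of x] wQ[of "M y"] that by (simp add: w)
  then have "\<exists>K K'. homeomorphism UNIV UNIV K K' \<and> (\<forall>z. \<forall>l\<in>\<Lambda>. K (z + l) = K z + l) \<and>
        (\<forall>z. w \<bullet> K (M z + G z) = m * (w \<bullet> K z))"
    if "continuous_on UNIV G" "bounded (range G)"
      "\<And>x y. norm (G x - G y) \<le> \<epsilon> * norm (x - y)"
      "\<And>z l. l \<in> \<Lambda> \<Longrightarrow> G (z + l) = G z" "\<And>l. l \<in> \<Lambda> \<Longrightarrow> M l \<in> \<Lambda>" for G :: "'a \<Rightarrow> 'a" and \<Lambda>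
    using K[OF that] by metis
  with \<epsilon> show thesis by (intro that[of \<epsilon>]) auto
qed

section \<open>An eigenrow of an integer matrix in unimodular coordinates\<close>

lemma det_of_int:
  fixes A :: "int ^ 'n ^ 'n"
  shows "Determinants.det (map_matrix of_int A :: 'a::comm_ring_1 ^ 'n ^ 'n) = of_int (Determinants.det A)"
  unfolding Determinants.det_def by (simp add: map_matrix_def)

lemma det_eq_0_iff_kernel:
  fixes A :: "'a::field ^ 'n ^ 'n"
  shows "Determinants.det A = 0 \<longleftrightarrow> (\<exists>v. v \<noteq> 0 \<and> A *v v = 0)"
  using matrix_left_invertible_ker[of A] invertible_det_nz[of A] invertible_left_inverse[of A] by blast

lemma common_denominator:
  fixes u :: "'i::finite \<Rightarrow> rat"
  obtains D :: int where "D \<noteq> 0" "\<And>i. of_int D * u i \<in> \<int>"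
proof -
  have "\<exists>D::int. D \<noteq> 0 \<and> (\<forall>i\<in>S. of_int D * u i \<in> \<int>)" if "finite S" for S
    using that
  proof (induction S rule: finite_induct)
    case (insert j S)
    then obtain D :: int where D: "D \<noteq> 0" "\<And>i. i \<in> S \<Longrightarrow> of_int D * u i \<in> \<int>" by blast
    obtain a b where ab: "quotient_of (u j) = (a, b)" by fastforce
    then have b: "b > 0" and u: "u j = of_int a / of_int b"
      by (auto intro: quotient_of_denom_pos quotient_of_div)
    have "of_int (b * D) * u i \<in> \<int>" if "i \<in> insert j S" for i
    proof (cases "i = j")
      case True
      then show ?thesis using b by (simp add: u)
    next
      case False
      then have "of_int D * u i \<in> \<int>" using D(2) that by auto
      then have "of_int b * (of_int D * u i) \<in> \<int>" by (rule Ints_mult[OF Ints_of_int])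
      then show ?thesis by (simp add: mult.assoc)
    qed
    then show ?case using D(1) b by (intro exI[of _ "b * D"]) auto
  qed (auto intro: exI[of _ 1])
  from this[of UNIV] show thesis using that by auto
qed

text \<open>
  The determinant of \<open>M - m\<close> is an integer, and it is zero because there is a real kernel vector. Hence
  the transposed matrix has a rational kernel vector, and clearing denominators makes it integral.
\<close>
lemma integer_left_eigenvector:
  fixes M :: "int ^ 'd ^ 'd" and m :: int
  assumes "\<exists>v :: real ^ 'd. v \<noteq> 0 \<and> map_matrix real_of_int M *v v = real_of_int m *\<^sub>R v"
  obtains w :: "'d \<Rightarrow> int" where "w \<noteq> (\<lambda>_. 0)"
    "\<And>j. (\<Sum>i\<in>UNIV. w i * vec_nth (vec_nth M i) j) = m * w j"
proof -
  define N :: "int ^ 'd ^ 'd" where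
    "N = (\<chi> i j. vec_nth (vec_nth M i) j - (if i = j then m else 0))"
  have shift: "(\<Sum>j\<in>UNIV. (a j - (if i = j then c else 0)) * x j) = (\<Sum>j\<in>UNIV. a j * x j) - c * x i"
    for a x :: "'d \<Rightarrow> 'a::comm_ring_1" and c i
    by (simp add: left_diff_distrib sum_subtractf if_distrib[of "\<lambda>t. t * _"] cong: if_cong)
  obtain v :: "real ^ 'd" where v: "v \<noteq> 0" "map_matrix real_of_int M *v v = real_of_int m *\<^sub>R v"
    using assms by blast
  have "map_matrix real_of_int N *v v = 0"
  proof (rule Finite_Cartesian_Product.vec_eq_iff[THEN iffD2], rule allI)
    fix i
    have "vec_nth (map_matrix real_of_int N *v v) i =
        (\<Sum>j\<in>UNIV. (real_of_int (vec_nth (vec_nth M i) j) - (if i = j then real_of_int m else 0)) * vec_nth v j)"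
      by (auto simp: matrix_vector_mult_def map_matrix_def N_def intro!: sum.cong)
    also have "\<dots> = vec_nth (map_matrix real_of_int M *v v) i - real_of_int m * vec_nth v i"
      unfolding shift by (simp add: matrix_vector_mult_def map_matrix_def)
    finally show "vec_nth (map_matrix real_of_int N *v v) i = vec_nth 0 i" by (simp add: v(2))
  qed
  then have "Determinants.det (map_matrix real_of_int N) = 0"
    using v(1) det_eq_0_iff_kernel by blast
  then have "Determinants.det N = 0" by (simp add: det_of_int)
  then have "Determinants.det (map_matrix rat_of_int (Finite_Cartesian_Product.transpose N)) = 0"
    by (simp add: det_of_int Determinants.det_transpose)
  then obtain u where u: "u \<noteq> 0" "map_matrix rat_of_int (Finite_Cartesian_Product.transpose N) *v u = 0"
    using det_eq_0_iff_kernel by blast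
  have u_eig: "(\<Sum>i\<in>UNIV. vec_nth u i * rat_of_int (vec_nth (vec_nth M i) j)) = of_int m * vec_nth u j" for j
  proof -
    have "0 = vec_nth (map_matrix rat_of_int (Finite_Cartesian_Product.transpose N) *v u) j"
      by (simp add: u(2))
    also have "\<dots> = (\<Sum>i\<in>UNIV. (of_int (vec_nth (vec_nth M i) j) - (if j = i then of_int m else 0)) * vec_nth u i)"
      by (auto simp: matrix_vector_mult_def map_matrix_def N_def Finite_Cartesian_Product.transpose_def intro!: sum.cong)
    also have "\<dots> = (\<Sum>i\<in>UNIV. of_int (vec_nth (vec_nth M i) j) * vec_nth u i) - of_int m * vec_nth u j"
      by (rule shift)
    finally show ?thesis by (simp add: mult.commute)
  qed
  obtain D where D: "D \<noteq> 0" "\<And>i. rat_of_int D * vec_nth u i \<in> \<int>"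
    using common_denominator[of "vec_nth u"] by blast
  define w where "w i = \<lfloor>rat_of_int D * vec_nth u i\<rfloor>" for i
  have w: "rat_of_int (w i) = of_int D * vec_nth u i" for i
    using D(2)[of i] by (auto simp: w_def elim!: Ints_cases)
  show thesis
  proof
    show "w \<noteq> (\<lambda>_. 0)"
    proof
      assume "w = (\<lambda>_. 0)"
      then have "vec_nth u i = 0" for i using w[of i] D(1) by simp
      then show False using u(1) by (simp add: Finite_Cartesian_Product.vec_eq_iff)
    qed
    fix j
    have "rat_of_int (\<Sum>i\<in>UNIV. w i * vec_nth (vec_nth M i) j) =
        of_int D * (\<Sum>i\<in>UNIV. vec_nth u i * rat_of_int (vec_nth (vec_nth M i) j))"
      by (simp add: w sum_distrib_left mult.assoc)
    also have "\<dots> = rat_of_int (m * w j)" by (simp add: u_eig w)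
    finally show "(\<Sum>i\<in>UNIV. w i * vec_nth (vec_nth M i) j) = m * w j" by (simp only: of_int_eq_iff)
  qed
qed

definition transvection :: "'d \<Rightarrow> 'd \<Rightarrow> int \<Rightarrow> int ^ 'd ^ 'd" where
  "transvection i j c = (\<chi> a b. (if a = b then 1 else 0) + (if a = i \<and> b = j then c else 0))"

lemma mult_transvection:
  "vec_nth (vec_nth (X ** transvection i j c) a) b =
    vec_nth (vec_nth X a) b + (if b = j then c * vec_nth (vec_nth X a) i else 0)"
proof -
  have "vec_nth (vec_nth (X ** transvection i j c) a) b =
      (\<Sum>k\<in>UNIV. vec_nth (vec_nth X a) k * (if k = b then 1 else 0)) +
      (\<Sum>k\<in>UNIV. vec_nth (vec_nth X a) k * (if k = i \<and> b = j then c else 0))"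
    by (simp add: matrix_matrix_mult_def transvection_def distrib_left sum.distrib)
  also have "(\<Sum>k\<in>UNIV. vec_nth (vec_nth X a) k * (if k = i \<and> b = j then c else 0)) =
      (\<Sum>k\<in>UNIV. if k = i then (if b = j then c * vec_nth (vec_nth X a) k else 0) else 0)"
    by (intro sum.cong) (auto simp: mult.commute)
  also have "(\<Sum>k\<in>UNIV. vec_nth (vec_nth X a) k * (if k = b then 1 else 0)) = vec_nth (vec_nth X a) b"
    by (simp add: if_distrib cong: if_cong)
  finally show ?thesis by simp
qed

lemma transvection_inverse:
  assumes "i \<noteq> j"
  shows "transvection i j c ** transvection i j (- c) = Finite_Cartesian_Product.mat 1"
  using assms
  by (simp add: Finite_Cartesian_Product.vec_eq_iff mult_transvection Finite_Cartesian_Product.mat_def)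
    (simp add: transvection_def)

text \<open>
  Euclid's algorithm. As long as two entries of \<open>w\<close> are nonzero, subtracting one of minimal modulus
  from the other, with the right sign, decreases the sum of the moduli and is a transvection.
  When one entry is left, \<open>w\<close> is a multiple of a unit vector.
\<close>
lemma unimodular_completion:
  fixes w :: "'d::finite \<Rightarrow> int"
  assumes "w \<noteq> (\<lambda>_. 0)"
  shows "\<exists>(R :: int ^ 'd ^ 'd) R' k g. g \<noteq> 0 \<and> R ** R' = Finite_Cartesian_Product.mat 1 \<and>
    R' ** R = Finite_Cartesian_Product.mat 1 \<and> (\<forall>j. w j = g * vec_nth (vec_nth R k) j)"
  using assms
proof (induction "\<Sum>i\<in>UNIV. nat \<bar>w i\<bar>" arbitrary: w rule: less_induct)
  case less
  show ?case
  proof (cases "\<exists>i j. i \<noteq> j \<and> w i \<noteq> 0 \<and> w j \<noteq> 0")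
    case False
    obtain k where "w k \<noteq> 0" using less.prems by auto
    with False have "w j = w k * vec_nth (vec_nth (Finite_Cartesian_Product.mat 1) k) j" for j
      by (auto simp: Finite_Cartesian_Product.mat_def)
    moreover have "Finite_Cartesian_Product.mat 1 ** Finite_Cartesian_Product.mat 1 =
        (Finite_Cartesian_Product.mat 1 :: int ^ 'd ^ 'd)" by (rule matrix_mul_lid)
    ultimately show ?thesis using \<open>w k \<noteq> 0\<close> by blast
  next
    case True
    then obtain i j where ij: "i \<noteq> j" "w i \<noteq> 0" "w j \<noteq> 0" "\<bar>w i\<bar> \<le> \<bar>w j\<bar>"
      by (metis linear)
    define s where "s = sgn (w i) * sgn (w j)"
    define w' where "w' = w(j := w j - s * w i)"
    have "\<bar>w' j\<bar> < \<bar>w j\<bar>"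
      using ij by (auto simp: w'_def s_def sgn_if abs_if split: if_splits)
    then have "(\<Sum>i\<in>UNIV. nat \<bar>w' i\<bar>) < (\<Sum>i\<in>UNIV. nat \<bar>w i\<bar>)"
      by (intro sum_strict_mono_ex1) (auto simp: w'_def)
    moreover have "w' i \<noteq> 0" using ij by (simp add: w'_def)
    then have "w' \<noteq> (\<lambda>_. 0)" by auto
    ultimately obtain R R' :: "int ^ 'd ^ 'd" and k g where
      R: "g \<noteq> 0" "R ** R' = Finite_Cartesian_Product.mat 1" "R' ** R = Finite_Cartesian_Product.mat 1"
      and w': "\<And>j. w' j = g * vec_nth (vec_nth R k) j"
      using less.hyps[of w'] by blast
    let ?E = "transvection i j s" and ?E' = "transvection i j (- s)"
    have E: "?E ** ?E' = Finite_Cartesian_Product.mat 1" "?E' ** ?E = Finite_Cartesian_Product.mat 1"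
      using transvection_inverse[OF ij(1), of s] transvection_inverse[OF ij(1), of "- s"] by simp_all
    have "(R ** ?E) ** (?E' ** R') = R ** (?E ** ?E') ** R'" by (simp only: matrix_mul_assoc)
    also have "\<dots> = Finite_Cartesian_Product.mat 1" by (simp add: E R)
    finally have 1: "(R ** ?E) ** (?E' ** R') = Finite_Cartesian_Product.mat 1" .
    have "(?E' ** R') ** (R ** ?E) = ?E' ** (R' ** R) ** ?E" by (simp only: matrix_mul_assoc)
    also have "\<dots> = Finite_Cartesian_Product.mat 1" by (simp add: E R)
    finally have 2: "(?E' ** R') ** (R ** ?E) = Finite_Cartesian_Product.mat 1" .
    have "w l = g * vec_nth (vec_nth (R ** ?E) k) l" for l
      using w'[of l] w'[of i] ij(1)
      by (simp add: mult_transvection w'_def distrib_left split: if_splits) (simp add: algebra_simps)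
    with R(1) 1 2 show ?thesis by blast
  qed
qed

text \<open>
  The left eigenvector is a multiple \<open>g\<close> of row \<open>k\<close> of \<open>R\<close>, and \<open>g\<close> cancels from the eigenvector equation.
\<close>
lemma unimodular_eigenrow:
  fixes M :: "int ^ 'd ^ 'd" and m :: int
  assumes "\<exists>v :: real ^ 'd. v \<noteq> 0 \<and> map_matrix real_of_int M *v v = real_of_int m *\<^sub>R v"
  obtains R R' :: "int ^ 'd ^ 'd" and k where "R ** R' = Finite_Cartesian_Product.mat 1"
    "R' ** R = Finite_Cartesian_Product.mat 1"
    "\<And>j. vec_nth (vec_nth (R ** M) k) j = m * vec_nth (vec_nth R k) j"
proof -
  obtain w where w: "w \<noteq> (\<lambda>_. 0)"
    "\<And>j. (\<Sum>i\<in>UNIV. w i * vec_nth (vec_nth M i) j) = m * w j"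
    using integer_left_eigenvector[OF assms] by blast
  obtain R R' :: "int ^ 'd ^ 'd" and k g where
    R: "g \<noteq> 0" "R ** R' = Finite_Cartesian_Product.mat 1" "R' ** R = Finite_Cartesian_Product.mat 1"
    and wR: "\<And>j. w j = g * vec_nth (vec_nth R k) j"
    using unimodular_completion[OF w(1)] by blast
  have "g * vec_nth (vec_nth (R ** M) k) j = g * (m * vec_nth (vec_nth R k) j)" for j
  proof -
    have "g * vec_nth (vec_nth (R ** M) k) j = (\<Sum>i\<in>UNIV. w i * vec_nth (vec_nth M i) j)"
      by (simp add: matrix_matrix_mult_def wR sum_distrib_left mult.assoc)
    then show ?thesis by (simp add: w(2)) (simp add: wR)
  qed
  then show thesis using R by (intro that[of R R' k]) auto
qed

section \<open>Tori as quotients of Euclidean space\<close>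

lemma torus_class_eq_iff:
  "torus_class I x = torus_class I y \<longleftrightarrow> (\<forall>i\<in>I. x i - y i \<in> \<int>)"
proof
  assume eq: "torus_class I x = torus_class I y"
  have "restrict x I \<in> torus_class I x" by (auto simp: torus_class_def)
  then have "restrict x I \<in> torus_class I y" unfolding eq .
  then show "\<forall>i\<in>I. x i - y i \<in> \<int>" by (auto simp: torus_class_def)
next
  assume "\<forall>i\<in>I. x i - y i \<in> \<int>"
  then show "torus_class I x = torus_class I y" by (intro torus_class_eq) simp
qed

lemma quotient_map_torus_class:
  "quotient_map (product_topology (\<lambda>_. euclideanreal) I) (torus I) (torus_class I)"
  unfolding torus_def by (rule quotient_map_quotient_topology)

text \<open>
  The saturation of an open set is the union of its integer translates. Openness matters because
  a product of quotient maps need not be a quotient map, whereas a product of open maps is open.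
\<close>
lemma open_map_torus_class:
  "open_map (product_topology (\<lambda>_. euclideanreal) I) (torus I) (torus_class I)"
  unfolding open_map_def
proof (intro allI impI)
  let ?X = "product_topology (\<lambda>_. euclideanreal) I :: ('a \<Rightarrow> real) topology"
  fix U assume U: "openin ?X U"
  have top: "topspace ?X = extensional I" by (simp add: PiE_UNIV_domain PiE_def)
  have "{x \<in> topspace ?X. torus_class I x \<in> torus_class I ` U} =
      (\<Union>n :: 'a \<Rightarrow> int. {x \<in> topspace ?X. (\<lambda>i\<in>I. x i + of_int (n i)) \<in> U})" (is "?L = ?R")
  proof
    show "?L \<subseteq> ?R"
    proof
      fix x assume "x \<in> ?L"
      then obtain y where y: "x \<in> topspace ?X" "y \<in> U" "torus_class I x = torus_class I y" by blast
      have "y = (\<lambda>i\<in>I. x i + of_int \<lfloor>y i - x i\<rfloor>)"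
      proof
        fix i
        show "y i = (\<lambda>i\<in>I. x i + of_int \<lfloor>y i - x i\<rfloor>) i"
        proof (cases "i \<in> I")
          case True
          then have "y i - x i \<in> \<int>" using y(3)[symmetric] unfolding torus_class_eq_iff by blast
          then show ?thesis using True by (auto elim!: Ints_cases)
        next
          case False
          then show ?thesis using openin_subset[OF U] y(2) top by (auto simp: extensional_def)
        qed
      qed
      with y have "(\<lambda>i\<in>I. x i + of_int \<lfloor>y i - x i\<rfloor>) \<in> U" by simp
      then show "x \<in> ?R" using y(1) by (intro UN_I[of "\<lambda>i. \<lfloor>y i - x i\<rfloor>"]) auto
    qed
    show "?R \<subseteq> ?L"
    proof
      fix x assume "x \<in> ?R"
      then obtain n :: "'a \<Rightarrow> int" where n: "x \<in> topspace ?X" "(\<lambda>i\<in>I. x i + of_int (n i)) \<in> U" by blast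
      have "torus_class I x = torus_class I (\<lambda>i\<in>I. x i + of_int (n i))"
        unfolding torus_class_eq_iff by simp
      then show "x \<in> ?L" using n by blast
    qed
  qed
  moreover have "openin ?X {x \<in> topspace ?X. (\<lambda>i\<in>I. x i + of_int (n i)) \<in> U}" for n :: "'a \<Rightarrow> int"
  proof (rule openin_continuous_map_preimage[OF _ U])
    show "continuous_map ?X ?X (\<lambda>x. \<lambda>i\<in>I. x i + of_int (n i))"
      unfolding continuous_map_componentwise
      by (auto intro!: continuous_map_add continuous_map_product_projection)
  qed
  ultimately have "openin ?X {x \<in> topspace ?X. torus_class I x \<in> torus_class I ` U}"
    by auto
  then show "openin (torus I) (torus_class I ` U)"
    unfolding torus_def openin_quotient_topology using openin_subset[OF U] by blast
qed

lemma open_map_prod_map: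
  assumes "open_map X X' f" "open_map Y Y' g"
  shows "open_map (prod_topology X Y) (prod_topology X' Y') (\<lambda>(x, y). (f x, g y))"
  unfolding open_map_def
proof (intro allI impI)
  fix W assume W: "openin (prod_topology X Y) W"
  show "openin (prod_topology X' Y') ((\<lambda>(x, y). (f x, g y)) ` W)"
    unfolding openin_prod_topology_alt
  proof (intro allI impI)
    fix a b assume "(a, b) \<in> (\<lambda>(x, y). (f x, g y)) ` W"
    then obtain x y where xy: "(x, y) \<in> W" "a = f x" "b = g y" by auto
    obtain U V where "openin X U" "openin Y V" "x \<in> U" "y \<in> V" "U \<times> V \<subseteq> W"
      using W[unfolded openin_prod_topology_alt, rule_format, OF xy(1)] by blast
    then show "\<exists>U V. openin X' U \<and> openin Y' V \<and> a \<in> U \<and> b \<in> V \<and> U \<times> V \<subseteq> (\<lambda>(x, y). (f x, g y)) ` W"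
      using assms xy unfolding open_map_def
      by (intro exI[of _ "f ` U"] exI[of _ "g ` V"]) fastforce
  qed
qed

lemma homeomorphic_map_of_quotients:
  assumes f: "quotient_map X Y f" and g: "quotient_map X Z g"
    and fibres: "\<And>x y. x \<in> topspace X \<Longrightarrow> y \<in> topspace X \<Longrightarrow> f x = f y \<longleftrightarrow> g x = g y"
  shows "\<exists>H. homeomorphic_map Y Z H \<and> (\<forall>x\<in>topspace X. H (f x) = g x)"
proof -
  obtain H where H: "continuous_map Y Z H" "\<And>x. x \<in> topspace X \<Longrightarrow> H (f x) = g x"
    using quotient_map_lift_exists[OF f quotient_imp_continuous_map[OF g]] fibres by metis
  obtain H' where H': "continuous_map Z Y H'" "\<And>x. x \<in> topspace X \<Longrightarrow> H' (g x) = f x"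
    using quotient_map_lift_exists[OF g quotient_imp_continuous_map[OF f]] fibres by metis
  have "homeomorphic_maps Y Z H H'"
    unfolding homeomorphic_maps_def
    using H H' quotient_imp_surjective_map[OF f] quotient_imp_surjective_map[OF g] by force
  then show ?thesis using H(2) homeomorphic_maps_imp_map by blast
qed

lemma continuous_map_vec_lambda:
  assumes "\<And>i. continuous_map X euclideanreal (\<lambda>x. f x i)"
  shows "continuous_map X (euclidean :: (real ^ 'n) topology) (\<lambda>x. vec_lambda (f x))"
  unfolding continuous_map_atin limitin_canonical_iff
proof
  fix x assume "x \<in> topspace X"
  then have "((\<lambda>x. f x i) \<longlongrightarrow> f x i) (atin X x)" for i
    using assms[of i] unfolding continuous_map_atin limitin_canonical_iff by blast
  then show "((\<lambda>x. vec_lambda (f x)) \<longlongrightarrow> vec_lambda (f x)) (atin X x)"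
    by (intro vec_tendstoI) simp
qed

definition coords :: "'j set \<Rightarrow> ('j \<Rightarrow> 'd::finite) \<Rightarrow> real ^ 'd \<Rightarrow> 'j \<Rightarrow> real" where
  "coords J e z = (\<lambda>j\<in>J. vec_nth z (e j))"

lemma continuous_map_coords:
  "continuous_map euclidean (product_topology (\<lambda>_. euclideanreal) J) (coords J e)"
  unfolding continuous_map_componentwise coords_def
  by (auto intro!: continuous_intros)

lemma homeomorphic_map_vec_nth:
  "homeomorphic_map (euclidean :: (real ^ 'd) topology) (product_topology (\<lambda>_. euclideanreal) UNIV) vec_nth"
proof -
  have "homeomorphic_maps (euclidean :: (real ^ 'd) topology) (product_topology (\<lambda>_. euclideanreal) UNIV)
      vec_nth vec_lambda"
    unfolding homeomorphic_maps_def
    using continuous_map_coords[of UNIV id]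
    by (auto intro!: continuous_map_vec_lambda continuous_map_product_projection
        simp: coords_def continuous_map_componentwise_UNIV)
  then show ?thesis by (rule homeomorphic_maps_imp_map)
qed

lemma quotient_map_torus_vec:
  "quotient_map (euclidean :: (real ^ 'd) topology) (torus UNIV) (\<lambda>z. torus_class UNIV (vec_nth z))"
proof -
  have "quotient_map (euclidean :: (real ^ 'd) topology) (product_topology (\<lambda>_. euclideanreal) UNIV) vec_nth"
    by (rule homeomorphic_map_vec_nth[unfolded homeomorphic_map_def, THEN conjunct1])
  from quotient_map_compose[OF this quotient_map_torus_class] show ?thesis by (simp add: o_def)
qed

lemma homeomorphic_map_split_coords:
  fixes k :: "'d::finite"
  assumes e: "bij_betw e J (- {k})"
  shows "homeomorphic_map (euclidean :: (real ^ 'd) topology)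
    (prod_topology (product_topology (\<lambda>_. euclideanreal) {..<1::nat}) (product_topology (\<lambda>_. euclideanreal) J))
    (\<lambda>z. (coords {..<1::nat} (\<lambda>_. k) z, coords J e z))"
proof -
  let ?A = "product_topology (\<lambda>_. euclideanreal) {..<1::nat}"
  let ?B = "product_topology (\<lambda>_. euclideanreal) J"
  let ?e' = "inv_into J e"
  let ?join = "\<lambda>(a, b). vec_lambda (\<lambda>i. if i = k then a 0 else b (?e' i)) :: real ^ 'd"
  have e'1: "?e' i \<in> J" "e (?e' i) = i" if "i \<noteq> k" for i
    using that e by (auto simp: bij_betw_def intro: inv_into_into f_inv_into_f)
  have e'2: "?e' (e j) = j" "e j \<noteq> k" if "j \<in> J" for j
    using that e by (auto simp: bij_betw_def)
  have "homeomorphic_maps euclidean (prod_topology ?A ?B)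
      (\<lambda>z. (coords {..<1::nat} (\<lambda>_. k) z, coords J e z)) ?join"
    unfolding homeomorphic_maps_def
  proof (intro conjI ballI)
    show "continuous_map euclidean (prod_topology ?A ?B) (\<lambda>z. (coords {..<1::nat} (\<lambda>_. k) z, coords J e z))"
      by (intro continuous_map_pairedI continuous_map_coords)
    have "continuous_map (prod_topology ?A ?B) euclideanreal (\<lambda>x. if i = k then fst x 0 else snd x (?e' i))" for i
    proof (cases "i = k")
      case True
      have "continuous_map (prod_topology ?A ?B) euclideanreal ((\<lambda>a. a 0) \<circ> fst)"
        by (rule continuous_map_compose[OF continuous_map_fst continuous_map_product_projection]) simp
      with True show ?thesis by (simp add: o_def)
    next
      case False
      have "continuous_map (prod_topology ?A ?B) euclideanreal ((\<lambda>b. b (?e' i)) \<circ> snd)"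
        using e'1(1)[OF False]
        by (rule continuous_map_compose[OF continuous_map_snd continuous_map_product_projection])
      with False show ?thesis by (simp add: o_def)
    qed
    then show "continuous_map (prod_topology ?A ?B) euclidean ?join"
      unfolding case_prod_beta by (rule continuous_map_vec_lambda)
    show "?join (coords {..<1::nat} (\<lambda>_. k) z, coords J e z) = z" for z
      using e'1 by (simp add: Finite_Cartesian_Product.vec_eq_iff coords_def)
    fix x assume "x \<in> topspace (prod_topology ?A ?B)"
    then obtain a b where x: "x = (a, b)" "a \<in> extensional {..<1}" "b \<in> extensional J"
      by (auto simp: PiE_def)
    have "coords {..<1::nat} (\<lambda>_. k) (?join (a, b)) = a"
      using x(2) by (auto simp: coords_def extensional_def fun_eq_iff)
    moreover have "coords J e (?join (a, b)) = b"
      using x(3) e'2 by (auto simp: coords_def extensional_def fun_eq_iff)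
    ultimately show "(coords {..<1::nat} (\<lambda>_. k) (?join x), coords J e (?join x)) = x"
      by (simp only: x)
  qed
  then show ?thesis by (rule homeomorphic_maps_imp_map)
qed

lemma quotient_map_split_torus:
  fixes k :: "'d::finite"
  assumes e: "bij_betw e J (- {k})"
  shows "quotient_map (euclidean :: (real ^ 'd) topology) (prod_topology (torus {..<1::nat}) (torus J))
    (\<lambda>z. (torus_class {..<1} (coords {..<1::nat} (\<lambda>_. k) z), torus_class J (coords J e z)))"
proof -
  let ?A = "product_topology (\<lambda>_. euclideanreal) {..<1::nat}"
  let ?B = "product_topology (\<lambda>_. euclideanreal) J"
  let ?q = "\<lambda>(a, b). (torus_class {..<1::nat} a, torus_class J b)"
  have surj: "torus_class I ` topspace (product_topology (\<lambda>_. euclideanreal) I) = topspace (torus I)"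
    for I :: "'i set"
    by (rule quotient_imp_surjective_map[OF quotient_map_torus_class])
  have "quotient_map (prod_topology ?A ?B) (prod_topology (torus {..<1}) (torus J)) ?q"
  proof (rule continuous_open_imp_quotient_map)
    show "continuous_map (prod_topology ?A ?B) (prod_topology (torus {..<1}) (torus J)) ?q"
      unfolding case_prod_beta
      by (intro continuous_map_pairedI
          continuous_map_compose[OF continuous_map_fst, unfolded o_def]
          continuous_map_compose[OF continuous_map_snd, unfolded o_def]
          quotient_imp_continuous_map quotient_map_torus_class)
    show "open_map (prod_topology ?A ?B) (prod_topology (torus {..<1}) (torus J)) ?q"
      by (intro open_map_prod_map open_map_torus_class)
    have "?q ` (topspace ?A \<times> topspace ?B) = torus_class {..<1} ` topspace ?A \<times> torus_class J ` topspace ?B"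
      by auto
    then show "?q ` topspace (prod_topology ?A ?B) = topspace (prod_topology (torus {..<1}) (torus J))"
      by (simp only: topspace_prod_topology surj)
  qed
  then have "quotient_map euclidean (prod_topology (torus {..<1}) (torus J))
      (?q \<circ> (\<lambda>z. (coords {..<1::nat} (\<lambda>_. k) z, coords J e z)))"
    using homeomorphic_map_split_coords[OF e] unfolding homeomorphic_map_def
    by (intro quotient_map_compose) auto
  then show ?thesis by (simp add: o_def)
qed

section \<open>Periodic maps\<close>

definition integer_lattice :: "(real ^ 'd) set" where
  "integer_lattice = {z. \<forall>i. vec_nth z i \<in> \<int>}"

lemma one_periodicD:
  assumes "one_periodic G" "l \<in> integer_lattice"
  shows "G (z + l) = G z"
proof -
  define n :: "int ^ 'a" where "n = (\<chi> i. \<lfloor>vec_nth l i\<rfloor>)"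
  have "vec_nth l i = real_of_int (vec_nth n i)" for i
  proof -
    have "vec_nth l i \<in> \<int>" using assms(2) by (simp add: integer_lattice_def)
    then show ?thesis by (auto simp: n_def elim!: Ints_cases)
  qed
  then have "l = (\<chi> i. real_of_int (vec_nth n i))" by (simp add: Finite_Cartesian_Product.vec_eq_iff)
  then show ?thesis using assms(1) unfolding one_periodic_def by blast
qed

lemma integer_matrix_lattice:
  assumes "l \<in> integer_lattice"
  shows "map_matrix real_of_int A *v l \<in> integer_lattice"
  using assms by (auto simp: integer_lattice_def matrix_vector_mult_def intro!: Ints_sum Ints_mult)

text \<open>
  Taking fractional parts shows that \<open>g\<close> attains all its values on the unit cube, which is compact.
\<close>
lemma bounded_range_periodic:
  fixes g :: "real ^ 'd \<Rightarrow> 'b::metric_space"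
  assumes cont: "continuous_on UNIV g" and per: "\<And>z l. l \<in> integer_lattice \<Longrightarrow> g (z + l) = g z"
  shows "bounded (range g)"
proof -
  let ?C = "cbox 0 (\<chi> i. 1) :: (real ^ 'd) set"
  have "range g \<subseteq> g ` ?C"
  proof
    fix y assume "y \<in> range g"
    then obtain z where y: "y = g z" by blast
    define z' l :: "real ^ 'd" where "z' = (\<chi> i. frac (vec_nth z i))" and "l = (\<chi> i. of_int \<lfloor>vec_nth z i\<rfloor>)"
    have "z = z' + l"
      by (simp add: Finite_Cartesian_Product.vec_eq_iff z'_def l_def frac_def)
    moreover have "l \<in> integer_lattice" by (simp add: integer_lattice_def l_def)
    ultimately have "y = g z'" using per y by simp
    moreover have "z' \<in> ?C"
      by (auto simp: mem_box_cart z'_def frac_ge_0 frac_lt_1[THEN less_imp_le])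
    ultimately show "y \<in> g ` ?C" by blast
  qed
  moreover have "compact (g ` ?C)"
    by (intro compact_continuous_image continuous_on_subset[OF cont]) auto
  ultimately show ?thesis using bounded_subset compact_imp_bounded by blast
qed

text \<open>
  The derivative of \<open>G\<close> is periodic too, so both suprema in \<open>C1_norm\<close> range over bounded sets and are genuine
  upper bounds; the mean value inequality then gives the Lipschitz estimate.
\<close>
lemma C1_norm_bounds:
  fixes G :: "real ^ 'd \<Rightarrow> real ^ 'd"
  assumes C1: "C1_map G" and per: "one_periodic G"
  shows "continuous_on UNIV G" "bounded (range G)"
    "norm (G x - G y) \<le> C1_norm G * norm (x - y)"
proof -
  obtain G' :: "real ^ 'd \<Rightarrow> (real ^ 'd) \<Rightarrow>\<^sub>L (real ^ 'd)" where
    G': "\<And>z. (G has_derivative blinfun_apply (G' z)) (at z)" and cont': "continuous_on UNIV G'"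
    using C1 unfolding C1_map_def by blast
  show cont: "continuous_on UNIV G"
    using G' by (auto intro!: continuous_at_imp_continuous_on has_derivative_continuous)
  show bdd: "bounded (range G)"
    by (intro bounded_range_periodic cont one_periodicD[OF per])
  have "G' (z + l) = G' z" if l: "l \<in> integer_lattice" for z l
  proof -
    have "((\<lambda>x. G (x + l)) has_derivative (\<lambda>v. blinfun_apply (G' (z + l)) v)) (at z)"
      by (rule has_derivative_compose[of "\<lambda>x. x + l", OF _ G']) (auto intro!: derivative_eq_intros)
    then have "(G has_derivative blinfun_apply (G' (z + l))) (at z)"
      by (simp add: one_periodicD[OF per l])
    then have "blinfun_apply (G' (z + l)) = blinfun_apply (G' z)"
      using G' has_derivative_unique by blast
    then show ?thesis by (simp add: blinfun_apply_inject)
  qed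
  then have bdd': "bounded (range G')" by (intro bounded_range_periodic cont')
  have onorm: "onorm (frechet_derivative G (at z)) = norm (G' z)" for z
    using frechet_derivative_at[OF G', of z] by (simp add: norm_blinfun.rep_eq)
  have bdd_above: "bdd_above (range (\<lambda>z. norm (g z)))" if "bounded (range g)"
    for g :: "real ^ 'd \<Rightarrow> 'c::real_normed_vector"
    using that by (auto simp: bounded_iff bdd_above_def)
  have "norm (G' z) \<le> (SUP z. norm (G' z))" for z
    by (rule cSUP_upper[OF UNIV_I bdd_above[OF bdd']])
  moreover have "0 \<le> (SUP z. norm (G z))"
    by (rule cSUP_upper2[OF bdd_above[OF bdd] UNIV_I norm_ge_zero])
  ultimately have "onorm (blinfun_apply (G' z)) \<le> C1_norm G" for z
    unfolding C1_norm_def onorm by (simp add: norm_blinfun.rep_eq[symmetric] add_increasing)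
  then show "norm (G x - G y) \<le> C1_norm G * norm (x - y)"
    using G' by (intro differentiable_bound[OF convex_UNIV, where f' = "\<lambda>z. blinfun_apply (G' z)"]) auto
qed

lemma map_matrix_of_int_mult:
  "map_matrix real_of_int (A ** B) = map_matrix real_of_int A ** map_matrix real_of_int B"
  by (simp add: Finite_Cartesian_Product.vec_eq_iff matrix_matrix_mult_def)

lemma expanding_singleton:
  assumes "1 < \<bar>m\<bar>"
  shows "expanding (Matrix.mat 1 1 (\<lambda>_. m))"
  unfolding expanding_def
proof (intro allI impI)
  fix \<mu> assume "eigenvalue (map_mat complex_of_int (Matrix.mat 1 1 (\<lambda>_. m))) \<mu>"
  then obtain v where v: "v \<in> carrier_vec 1" "v \<noteq> 0\<^sub>v 1"
    "map_mat complex_of_int (Matrix.mat 1 1 (\<lambda>_. m)) *\<^sub>v v = \<mu> \<cdot>\<^sub>v v"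
    by (auto simp: eigenvalue_def eigenvector_def)
  have "vec_index v 0 \<noteq> 0" using v(1,2) by (auto simp: Matrix.vec_eq_iff)
  moreover have "of_int m * vec_index v 0 = \<mu> * vec_index v 0"
    using arg_cong[OF v(3), of "\<lambda>u. vec_index u 0"] v(1)
    by (simp add: scalar_prod_def)
  ultimately have "\<mu> = of_int m" by simp
  then show "1 < cmod \<mu>" using assms by simp
qed

section \<open>Conjugacy to a skew product\<close>

theorem corollary3p2:
  fixes M :: "int ^ 'd ^ 'd" and m :: int
  assumes "\<exists>v :: real ^ 'd. v \<noteq> 0 \<and> map_matrix real_of_int M *v v = real_of_int m *\<^sub>R v"
    and "\<bar>m\<bar> > 1"
  shows "\<exists>\<delta>>0. \<forall>G :: real ^ 'd \<Rightarrow> real ^ 'd.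
    C1_map G \<and> one_periodic G \<and> C1_norm G < \<delta> \<longrightarrow>
    (\<exists>k A Fy. 1 \<le> k \<and> k \<le> CARD('d) \<and> A \<in> carrier_mat k k \<and> expanding A \<and>
       continuous_map (prod_topology (torus {..<k}) (torus {..<CARD('d) - k}))
         (torus {..<CARD('d) - k}) Fy \<and>
       conjugate_maps (torus (UNIV :: 'd set))
         (torus_map UNIV (vec_nth \<circ> (\<lambda>z. map_matrix real_of_int M *v z + G z) \<circ> vec_lambda))
         (prod_topology (torus {..<k}) (torus {..<CARD('d) - k}))
         (skew_product A Fy))"
proof -
  let ?M = "map_matrix real_of_int M"
  obtain R R' :: "int ^ 'd ^ 'd" and i\<^sub>0 where
    RR': "R ** R' = Finite_Cartesian_Product.mat 1" "R' ** R = Finite_Cartesian_Product.mat 1"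
    and row: "\<And>j. vec_nth (vec_nth (R ** M) i\<^sub>0) j = m * vec_nth (vec_nth R i\<^sub>0) j"
    using unimodular_eigenrow[OF assms(1)] by blast
  let ?R = "map_matrix real_of_int R" and ?R' = "map_matrix real_of_int R'"
  have of_int_one: "map_matrix real_of_int (Finite_Cartesian_Product.mat 1) = (Finite_Cartesian_Product.mat 1 :: real ^ 'd ^ 'd)"
    by (simp add: Finite_Cartesian_Product.vec_eq_iff Finite_Cartesian_Product.mat_def)
  have R_inv: "?R' *v (?R *v z) = z" "?R *v (?R' *v z) = z" for z
    using RR' by (simp_all add: matrix_vector_mul_assoc map_matrix_of_int_mult[symmetric] of_int_one)
  define w :: "real ^ 'd" where "w = (\<chi> j. real_of_int (vec_nth (vec_nth R i\<^sub>0) j))"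
  have w: "w \<bullet> z = vec_nth (?R *v z) i\<^sub>0" for z
    by (simp add: w_def inner_vec_def matrix_vector_mult_def)
  have wM: "w \<bullet> (?M *v z) = real_of_int m * (w \<bullet> z)" for z
  proof -
    have "w \<bullet> (?M *v z) = vec_nth (map_matrix real_of_int (R ** M) *v z) i\<^sub>0"
      by (simp add: w matrix_vector_mul_assoc map_matrix_of_int_mult)
    also have "\<dots> = real_of_int m * (w \<bullet> z)"
      by (simp add: matrix_vector_mult_def row w_def inner_vec_def sum_distrib_left mult.assoc)
    finally show ?thesis .
  qed
  have "1 < \<bar>real_of_int m\<bar>" using assms(2) by simp
  then obtain \<epsilon> where \<epsilon>: "\<epsilon> > 0" and straighten:
    "\<And>(G::real ^ 'd \<Rightarrow> real ^ 'd) \<Lambda>. continuous_on UNIV G \<Longrightarrow> bounded (range G) \<Longrightarrow>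
      (\<And>x y. norm (G x - G y) \<le> \<epsilon> * norm (x - y)) \<Longrightarrow>
      (\<And>z l. l \<in> \<Lambda> \<Longrightarrow> G (z + l) = G z) \<Longrightarrow> (\<And>l. l \<in> \<Lambda> \<Longrightarrow> ?M *v l \<in> \<Lambda>) \<Longrightarrow>
      \<exists>K K'. homeomorphism UNIV UNIV K K' \<and> (\<forall>z. \<forall>l\<in>\<Lambda>. K (z + l) = K z + l) \<and>
        (\<forall>z. w \<bullet> K (?M *v z + G z) = real_of_int m * (w \<bullet> K z))"
    using straightening[of "(*v) ?M" w "real_of_int m"] matrix_vector_mul_linear wM by metis

  let ?J = "{..<CARD('d) - 1}"
  let ?X = "torus (UNIV :: 'd set)" and ?Y = "prod_topology (torus {..<1::nat}) (torus ?J)"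
  let ?A = "Matrix.mat 1 1 (\<lambda>_. m)"
  have "card (- {i\<^sub>0}) = CARD('d) - 1" by (simp add: Compl_eq_Diff_UNIV card_Diff_singleton)
  then obtain e where e: "bij_betw e ?J (- {i\<^sub>0})"
    using ex_bij_betw_nat_finite[of "- {i\<^sub>0}"] by (auto simp: atLeast0LessThan)

  have conjugacy: "\<exists>Fy. continuous_map ?Y (torus ?J) Fy \<and>
      conjugate_maps ?X (torus_map UNIV (vec_nth \<circ> (\<lambda>z. ?M *v z + G z) \<circ> vec_lambda)) ?Y (skew_product ?A Fy)"
    if C1: "C1_map G" and per: "one_periodic G" and small: "C1_norm G < \<epsilon>" for G
  proof -
    define f where "f z = ?M *v z + G z" for z
    define F where "F = torus_map UNIV (vec_nth \<circ> (\<lambda>z. ?M *v z + G z) \<circ> vec_lambda)"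
    note G = C1_norm_bounds[OF C1 per]
    have "norm (G x - G y) \<le> \<epsilon> * norm (x - y)" for x y
      using G(3)[of x y] mult_right_mono[of "C1_norm G" \<epsilon> "norm (x - y)"] small by simp
    then obtain K K' where hom: "homeomorphism UNIV UNIV K K'"
      and K_per: "\<And>z l. l \<in> integer_lattice \<Longrightarrow> K (z + l) = K z + l"
      and K_f: "\<And>z. w \<bullet> K (f z) = real_of_int m * (w \<bullet> K z)"
      using straighten[of G integer_lattice] G(1,2) one_periodicD[OF per] integer_matrix_lattice
      unfolding f_def by blast
    have K_inj: "K x = K y \<Longrightarrow> x = y" for x y using hom by (metis homeomorphism_apply1 UNIV_I)
    define \<kappa> where "\<kappa> z = ?R *v K z" for z
    have K_lattice: "K x - K y \<in> integer_lattice \<longleftrightarrow> x - y \<in> integer_lattice" for x y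
    proof
      assume "x - y \<in> integer_lattice"
      then show "K x - K y \<in> integer_lattice" using K_per[of "x - y" y] by simp
    next
      assume l: "K x - K y \<in> integer_lattice"
      then have "K (y + (K x - K y)) = K x" using K_per[OF l, of y] by simp
      then have "x - y = K x - K y" using K_inj by (metis add_diff_cancel_left')
      with l show "x - y \<in> integer_lattice" by simp
    qed
    \<comment> \<open>\<open>R\<close> and its inverse are both integral, so they preserve the lattice in both directions.\<close>
    have \<kappa>_lattice: "\<kappa> x - \<kappa> y \<in> integer_lattice \<longleftrightarrow> x - y \<in> integer_lattice" for x y
    proof -
      have "\<kappa> x - \<kappa> y \<in> integer_lattice \<longleftrightarrow> K x - K y \<in> integer_lattice"
        using integer_matrix_lattice[of "K x - K y" R] integer_matrix_lattice[of "?R *v (K x - K y)" R']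
        by (auto simp: \<kappa>_def R_inv(1) matrix_vector_mult_diff_distrib[symmetric])
      then show ?thesis by (simp only: K_lattice)
    qed
    have \<kappa>_hom: "homeomorphic_map euclidean euclidean \<kappa>"
    proof -
      have lin: "continuous_on UNIV ((*v) A)" for A :: "real ^ 'd ^ 'd"
        by (rule matrix_vector_mult_linear_continuous_on)
      have "continuous_on UNIV K" "continuous_on UNIV K'" using hom by (auto simp: homeomorphism_def)
      then have "homeomorphic_maps euclidean euclidean \<kappa> (\<lambda>z. K' (?R' *v z))"
        unfolding homeomorphic_maps_def \<kappa>_def
        using continuous_on_compose2[OF lin, of UNIV K] continuous_on_compose2[of UNIV K' UNIV, OF _ lin] hom
        by (auto simp: R_inv homeomorphism_def)
      then show ?thesis by (rule homeomorphic_maps_imp_map)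
    qed

    let ?q = "\<lambda>z. torus_class UNIV (vec_nth z)"
    let ?s = "\<lambda>z. (torus_class {..<1::nat} (coords {..<1} (\<lambda>_. i\<^sub>0) z), torus_class ?J (coords ?J e z))"
    have q_eq: "?q x = ?q y \<longleftrightarrow> x - y \<in> integer_lattice" for x y
      by (simp add: torus_class_eq_iff integer_lattice_def)
    have s_eq: "?s x = ?s y \<longleftrightarrow> x - y \<in> integer_lattice" for x y
    proof -
      have "?s x = ?s y \<longleftrightarrow> vec_nth x i\<^sub>0 - vec_nth y i\<^sub>0 \<in> \<int> \<and> (\<forall>j\<in>?J. vec_nth x (e j) - vec_nth y (e j) \<in> \<int>)"
        by (auto simp: torus_class_eq_iff coords_def)
      also have "(\<forall>j\<in>?J. vec_nth x (e j) - vec_nth y (e j) \<in> \<int>) \<longleftrightarrow>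
          (\<forall>i\<in>e ` ?J. vec_nth x i - vec_nth y i \<in> \<int>)" by blast
      also have "e ` ?J = - {i\<^sub>0}" using e by (simp add: bij_betw_def)
      finally show ?thesis by (auto simp: integer_lattice_def)
    qed
    have quot: "quotient_map euclidean ?Y (?s \<circ> \<kappa>)"
      using \<kappa>_hom quotient_map_split_torus[OF e] unfolding homeomorphic_map_def
      by (intro quotient_map_compose) auto
    have fibres: "?q x = ?q y \<longleftrightarrow> (?s \<circ> \<kappa>) x = (?s \<circ> \<kappa>) y" for x y
      by (simp only: q_eq s_eq \<kappa>_lattice o_apply)
    obtain H where H: "homeomorphic_map ?X ?Y H" "\<And>z. H (?q z) = ?s (\<kappa> z)"
      using homeomorphic_map_of_quotients[OF quotient_map_torus_vec quot fibres] by auto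
    then obtain H' where H': "homeomorphic_maps ?X ?Y H H'" using homeomorphic_map_maps by blast

    have F: "F (?q z) = ?q (f z)" for z
      unfolding F_def f_def by (rule torus_map_perturbed_linear[OF per])
    have f_cont: "continuous_map euclidean euclidean f"
      using G(1) matrix_vector_mult_linear_continuous_on[of UNIV ?M]
      by (auto simp: f_def intro!: continuous_on_add)
    have F_cont: "continuous_map ?X ?X F"
    proof (rule continuous_compose_quotient_map[OF quotient_map_torus_vec])
      have "continuous_map euclidean ?X (?q \<circ> f)"
        by (rule continuous_map_compose[OF f_cont quotient_imp_continuous_map[OF quotient_map_torus_vec]])
      then show "continuous_map euclidean ?X (F \<circ> ?q)" by (simp add: o_def F)
    qed

    \<comment> \<open>The second component of the transported map is \<open>Fy\<close> by definition; what remains is to identify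
      the first.\<close>
    define Fy where "Fy = snd \<circ> H \<circ> F \<circ> H'"
    have "continuous_map ?Y (torus ?J) Fy"
      unfolding Fy_def using H' F_cont
      by (intro continuous_map_compose[of _ ?X] continuous_map_compose[of _ ?Y] continuous_map_snd)
        (auto simp: homeomorphic_maps_def)
    moreover have "H (F C) = skew_product ?A Fy (H C)" if "C \<in> topspace ?X" for C
    proof -
      have "?q ` UNIV = topspace ?X"
        using quotient_imp_surjective_map[OF quotient_map_torus_vec] by simp
      with that obtain z where C: "C = ?q z" by blast
      let ?x = "\<lambda>z. coords {..<1::nat} (\<lambda>_. i\<^sub>0) z"
      have "mat_act ?A (?x (\<kappa> z)) = ?x (\<kappa> (f z))"
        using K_f[of z] by (auto simp: mat_act_def coords_def \<kappa>_def w)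
      then have "torus_map {..<1} (mat_act ?A) (torus_class {..<1} (?x (\<kappa> z))) =
          torus_class {..<1} (?x (\<kappa> (f z)))"
        using torus_map_mat_act[of ?A 1 "?x (\<kappa> z)"] by (simp add: coords_def)
      moreover have "Fy (H C) = snd (H (F C))"
        using H' that by (simp add: Fy_def homeomorphic_maps_def)
      ultimately show ?thesis
        by (simp add: skew_product_def C F H(2))
    qed
    ultimately show ?thesis
      using H(1) unfolding conjugate_maps_def F_def by blast
  qed
  show ?thesis
  proof (intro exI[of _ \<epsilon>] conjI allI impI \<epsilon>, elim conjE)
    fix G :: "real ^ 'd \<Rightarrow> real ^ 'd"
    assume "C1_map G" "one_periodic G" "C1_norm G < \<epsilon>"
    from conjugacy[OF this] obtain Fy where Fy: "continuous_map ?Y (torus ?J) Fy"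
      "conjugate_maps ?X (torus_map UNIV (vec_nth \<circ> (\<lambda>z. ?M *v z + G z) \<circ> vec_lambda)) ?Y (skew_product ?A Fy)"
      by blast
    have "1 \<le> CARD('d)" by (simp add: Suc_le_eq)
    moreover have "?A \<in> carrier_mat 1 1" by simp
    ultimately show "\<exists>k A Fy. 1 \<le> k \<and> k \<le> CARD('d) \<and> A \<in> carrier_mat k k \<and> expanding A \<and>
       continuous_map (prod_topology (torus {..<k}) (torus {..<CARD('d) - k})) (torus {..<CARD('d) - k}) Fy \<and>
       conjugate_maps ?X (torus_map UNIV (vec_nth \<circ> (\<lambda>z. ?M *v z + G z) \<circ> vec_lambda))
         (prod_topology (torus {..<k}) (torus {..<CARD('d) - k})) (skew_product A Fy)"
      using expanding_singleton[OF assms(2)] Fy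
      by (intro exI[of _ "1::nat"] exI[of _ ?A] exI[of _ Fy] conjI order_refl)
  qed
qed

end
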